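(* Let $\alpha\in(0,2)$, let $n\ge1$ be an integer with $n>\alpha$, and let $p,s>1$ and $\kappa_1,\kappa_2>0$ be real numbers. Let $u,v\in L_\alpha\cap C^{1,1}_{loc}(\mathbb{R}^n)$ be a positive solution of the system $$(-\Delta)^{\alpha/2}u(x)=v(x)^{\frac{n+\alpha}{n-\alpha}}-\kappa_1u(x)^p,\quad (-\Delta)^{\alpha/2}v(x)=u(x)^{\frac{n+\alpha}{n-\alpha}}-\kappa_2v(x)^s,\quad u(x)>0,\ v(x)>0,\qquad x\in\mathbb{R}^n.$$ If $u(x)\lesssim|x|^{-(n-\alpha)}$ and $v(x)\lesssim|x|^{-(n-\alpha)}$ as $|x|\to\infty$, then there exists a point $x_0\in\mathbb{R}^n$ such that both $u$ and $v$ are radially symmetric about $x_0$, i.e. $u(x)$ and $v(x)$ depend only on $|x-x_0|$.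
   Context: For $\alpha\in(0,2)$, the fractional Laplacian is $$(-\Delta)^{\alpha/2}u(x)=C_{n,\alpha}\lim_{\epsilon\to0}\int_{\mathbb{R}^n\setminus B_\epsilon(x)}\frac{u(x)-u(y)}{|x-y|^{n+\alpha}}\,dy,$$ where $C_{n,\alpha}>0$ is a normalization constant. $L_\alpha$ is the set of functions $u:\mathbb{R}^n\to\mathbb{R}$ with $\int_{\mathbb{R}^n}\frac{|u(x)|}{1+|x|^{n+\alpha}}dx<+\infty$. $C^{1,1}_{loc}(\mathbb{R}^n)$ is the set of $C^1$ functions with locally Lipschitz gradient. For $u\in L_\alpha\cap C^{1,1}_{loc}(\mathbb{R}^n)$ the limit as $\epsilon\to0$ defining $(-\Delta)^{\alpha/2}u(x)$ is well defined at every point, and equations are understood pointwise. The notation $u(x)\lesssim|x|^{-a}$ as $|x|\to\infty$ means there is $R>0$ with $u(x)\le|x|^{-a}$ for all $|x|>R$. *)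

theory Defs
  imports "HOL-Analysis.Analysis"
begin

text \<open>
  The dimension is the size of the index type of \<open>real ^ 'n\<close>.  The normalization
  constant of the fractional Laplacian is a parameter \<open>C\<close>; only its positivity is ever assumed.
\<close>

text \<open>
  For \<open>u\<close> in \<open>L_space \<alpha>\<close> that is also in \<open>C11_loc\<close>, the limit below exists at every point
  (and the integrands are absolutely integrable for every \<open>\<epsilon> > 0\<close>), so that \<open>Lim\<close> and the
  integral have their usual meaning.
\<close>

definition frac_laplacian :: "real \<Rightarrow> real \<Rightarrow> (real ^ 'n \<Rightarrow> real) \<Rightarrow> real ^ 'n \<Rightarrow> real" where
  "frac_laplacian C \<alpha> u x =
     C * Lim (at_right 0)
           (\<lambda>\<epsilon>. LINT y:(- ball x \<epsilon>)|lebesgue.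
                   (u x - u y) / norm (x - y) powr (real CARD('n) + \<alpha>))"

definition L_space :: "real \<Rightarrow> (real ^ 'n \<Rightarrow> real) set" where
  "L_space \<alpha> = {u. u \<in> borel_measurable lebesgue \<and>
     integrable lebesgue (\<lambda>x. \<bar>u x\<bar> / (1 + norm x powr (real CARD('n) + \<alpha>)))}"

definition C11_loc :: "(real ^ 'n \<Rightarrow> real) set" where
  "C11_loc = {u. \<exists>g :: real ^ 'n \<Rightarrow> real ^ 'n.
     (\<forall>x. GDERIV u x :> g x) \<and> continuous_on UNIV g \<and>
     (\<forall>x. \<exists>r>0. \<exists>K. K-lipschitz_on (ball x r) g)}"

text \<open>The comparison at infinity is with constant exactly 1.\<close>

definition decays_like :: "(real ^ 'n \<Rightarrow> real) \<Rightarrow> real \<Rightarrow> bool" where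
  "decays_like u a \<longleftrightarrow> (\<exists>R>0. \<forall>x. norm x > R \<longrightarrow> u x \<le> norm x powr (- a))"

definition radially_symmetric_about :: "real ^ 'n \<Rightarrow> (real ^ 'n \<Rightarrow> real) \<Rightarrow> bool" where
  "radially_symmetric_about x0 u \<longleftrightarrow>
     (\<forall>x y. norm (x - x0) = norm (y - x0) \<longrightarrow> u x = u y)"

end

theory Submission imports Defs begin

text \<open>
  The proof moves hyperplanes directly, on the level of the singular integral. Fix a unit vector
  \<open>e\<close>, and compare \<open>u\<close> and \<open>v\<close> on the half-space \<open>x \<bullet> e < l\<close> with their reflections in its boundary; the gaps
  are \<open>U y = u (reflect e l y) - u y\<close>, and \<open>V\<close> in the same way for \<open>v\<close>.

  Two facts carry the argument. First, at a negative minimum \<open>x\<close> of \<open>U\<close> in the half-space, at distance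
  \<open>\<delta>\<close> from the plane, the fractional Laplacian of \<open>U\<close> is at most \<open>c * \<delta> powr (- \<alpha>) * U x\<close>
  (\<open>gap_operator_at_negative_minimum\<close>). Second, the right-hand side of the equation is at least a multiple of
  \<open>v x powr (\<beta> - 1) * V x\<close>, where \<open>\<beta>\<close> is the critical exponent: the damping terms
  help, being increasing in the unknown. The decay of \<open>v\<close> turns the coefficient into
  \<open>(1 + norm x) powr (- 2 * \<alpha>)\<close>. Multiplying the estimates of the two equations eliminates the values of
  the gaps and leaves
  \<open>((1 + norm x) * (1 + norm y))\<^sup>2 \<le> const * (\<delta> * \<eta>)\<close>
  for the minima \<open>x\<close> and \<open>y\<close> of \<open>U\<close> and \<open>V\<close>, with \<open>\<eta>\<close> the distance of \<open>y\<close> from the plane and a constant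
  independent of the plane (\<open>negative_minima_located\<close>).

  This inequality controls the whole motion of the plane. It excludes negative gaps when \<open>l\<close> is very
  negative. For bounded \<open>l\<close> it confines the minima to a compact set that stays away from the plane. So at the last
  offset at which both gaps are nonnegative, \<open>U\<close> cannot be strictly positive on the half-space: otherwise both
  gaps would still be nonnegative after a small shift. By the strong maximum principle (\<open>gap_operator_at_zero_minimum\<close>) both
  functions are then symmetric (\<open>symmetry_plane_exists\<close>). As this holds for every direction, the barycentre of a
  superlevel set of \<open>u\<close> is a centre of symmetry (\<open>radially_symmetric_of_symmetry_planes\<close>).

  The operator is the limit of truncated integrals, so it must also be shown that this limit exists
  (\<open>truncated_integral_tendsto_frac_laplacian\<close>); symmetrizing the integrand in the point \<open>x\<close> gives
  absolute convergence.
\<close>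

section \<open>Lebesgue measure under isometric involutions\<close>

lemma isometric_involution_ball:
  fixes f :: "'a::metric_space \<Rightarrow> 'a"
  assumes inv: "\<And>x. f (f x) = x" and iso: "\<And>x y. dist (f x) (f y) = dist x y"
  shows "f ` ball a r = ball (f a) r"
proof (intro set_eqI iffI)
  fix y assume "y \<in> ball (f a) r"
  then have "f y \<in> ball a r" by (metis inv iso mem_ball)
  then show "y \<in> f ` ball a r" by (metis inv image_eqI)
qed (auto simp: iso)

text \<open>
  By the Vitali covering theorem an open set is, up to a null set, a disjoint union of balls.
  An isometric involution maps balls to balls of the same radius and null sets to null sets, so
  invariance follows without any determinant, and in every Euclidean space.
\<close>

lemma emeasure_isometric_involution_le:
  fixes f :: "'a::euclidean_space \<Rightarrow> 'a"
  assumes inv: "\<And>x. f (f x) = x" and iso: "\<And>x y. dist (f x) (f y) = dist x y"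
    and U: "open U"
  shows "emeasure lebesgue (f ` U) \<le> emeasure lebesgue U"
proof -
  define K where "K = {i :: 'a \<times> real. 0 < snd i \<and> ball (fst i) (snd i) \<subseteq> U}"
  have K: "\<exists>i. i \<in> K \<and> x \<in> ball (fst i) (snd i) \<and> snd i < d" if "x \<in> U" "0 < d" for x d
  proof -
    obtain r where r: "r > 0" "ball x r \<subseteq> U"
      using U \<open>x \<in> U\<close> openE by blast
    have "(x, min r (d/2)) \<in> K" "x \<in> ball x (min r (d/2))" "min r (d/2) < d"
      using r \<open>0 < d\<close> by (auto simp: K_def)
    then show ?thesis by force
  qed
  obtain C where C: "countable C" "C \<subseteq> K"
     "pairwise (\<lambda>i j. disjnt (ball (fst i) (snd i)) (ball (fst j) (snd j))) C"
     "negligible (U - (\<Union>i \<in> C. ball (fst i) (snd i)))"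
    using Vitali_covering_theorem_balls[of U K fst snd] K by blast
  define N where "N = U - (\<Union>i \<in> C. ball (fst i) (snd i))"
  have "negligible (f ` N)"
  proof (rule negligible_locally_Lipschitz_image)
    show "negligible N" using C by (simp add: N_def)
    fix x show "\<exists>T B. open T \<and> x \<in> T \<and> (\<forall>y\<in>N \<inter> T. norm (f y - f x) \<le> B * norm (y - x))"
      using iso by (intro exI[of _ UNIV] exI[of _ 1]) (auto simp: dist_norm)
  qed simp
  then have N: "f ` N \<in> null_sets lebesgue" by (simp add: negligible_iff_null_sets)
  have ball: "f ` ball a r = ball (f a) r" for a r
    by (rule isometric_involution_ball[OF inv iso])
  have "f ` U \<subseteq> (\<Union>i \<in> C. ball (f (fst i)) (snd i)) \<union> f ` N"
    unfolding ball[symmetric] N_def by blast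
  then have "emeasure lebesgue (f ` U) \<le> emeasure lebesgue ((\<Union>i \<in> C. ball (f (fst i)) (snd i)) \<union> f ` N)"
    using N C(1) by (intro emeasure_mono) (auto intro!: sets.countable_UN'')
  also have "\<dots> = emeasure lebesgue (\<Union>i \<in> C. ball (f (fst i)) (snd i))"
    using N C(1) by (intro emeasure_Un_null_set) (auto intro!: sets.countable_UN'')
  also have "\<dots> = (\<integral>\<^sup>+i. emeasure lebesgue (ball (f (fst i)) (snd i)) \<partial>count_space C)"
  proof (rule emeasure_UN_countable)
    have "f ` ball (fst i) (snd i) \<inter> f ` ball (fst j) (snd j) = {}" if "i \<in> C" "j \<in> C" "i \<noteq> j" for i j
    proof -
      have "ball (fst i) (snd i) \<inter> ball (fst j) (snd j) = {}"
        using C(3) that by (auto simp: pairwise_def disjnt_def)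
      moreover have "inj f" using inv by (metis injI)
      ultimately show ?thesis by (metis image_Int image_empty)
    qed
    then show "disjoint_family_on (\<lambda>i. ball (f (fst i)) (snd i)) C"
      unfolding disjoint_family_on_def ball by blast
  qed (use C in auto)
  also have "\<dots> = (\<integral>\<^sup>+i. emeasure lebesgue (ball (fst i) (snd i)) \<partial>count_space C)"
    using C(2) by (intro nn_integral_cong) (auto simp: K_def emeasure_ball less_imp_le)
  also have "\<dots> = emeasure lebesgue (\<Union>i \<in> C. ball (fst i) (snd i))"
    using C by (intro emeasure_UN_countable[symmetric])
      (auto simp: disjoint_family_on_def pairwise_def disjnt_def)
  also have "\<dots> \<le> emeasure lebesgue U"
    using C U by (intro emeasure_mono) (auto simp: K_def)
  finally show ?thesis .
qed

text \<open>
  Applying the inequality to a box and to its image gives equality, since the map is its own inverse.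
  Both point reflections and reflections in hyperplanes are of this kind.
\<close>

theorem lborel_distr_isometric_involution:
  fixes f :: "'a::euclidean_space \<Rightarrow> 'a"
  assumes inv: "\<And>x. f (f x) = x" and iso: "\<And>x y. dist (f x) (f y) = dist x y"
  shows "distr lborel borel f = lborel"
proof (rule lborel_eqI[symmetric])
  fix l u :: 'a
  assume lu: "\<And>b. b \<in> Basis \<Longrightarrow> l \<bullet> b \<le> u \<bullet> b"
  have cont: "continuous_on UNIV f"
    unfolding continuous_on_iff using iso by metis
  then have [measurable]: "f \<in> borel_measurable borel"
    by (rule borel_measurable_continuous_onI)
  have vim: "f -` A = f ` A" for A
    using inv by (auto simp: image_iff) metis
  have op: "open (f ` box l u)"
    unfolding vim[symmetric] using cont open_box by (rule open_vimage[rotated])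
  have "emeasure lebesgue (f ` box l u) \<le> emeasure lebesgue (box l u)"
    by (rule emeasure_isometric_involution_le[OF inv iso]) auto
  moreover have "emeasure lebesgue (f ` f ` box l u) \<le> emeasure lebesgue (f ` box l u)"
    by (rule emeasure_isometric_involution_le[OF inv iso op])
  moreover have "f ` f ` box l u = box l u" by (simp add: image_image inv)
  ultimately have "emeasure lborel (f ` box l u) = emeasure lborel (box l u)"
    using op by simp
  then show "emeasure (distr lborel borel f) (box l u) = (\<Prod>b\<in>Basis. (u - l) \<bullet> b)"
    using lu by (simp add: emeasure_distr vim emeasure_lborel_box)
qed simp

lemma integral_isometric_involution:
  fixes f :: "'a::euclidean_space \<Rightarrow> 'a" and g :: "'a \<Rightarrow> 'b::{banach, second_countable_topology}"
  assumes inv: "\<And>x. f (f x) = x" and iso: "\<And>x y. dist (f x) (f y) = dist x y"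
    and g: "g \<in> borel_measurable borel"
  shows "integrable lborel (\<lambda>x. g (f x)) \<longleftrightarrow> integrable lborel g"
    and "(LINT x|lborel. g (f x)) = (LINT x|lborel. g x)"
proof -
  have "continuous_on UNIV f"
    unfolding continuous_on_iff using iso by metis
  then have f: "f \<in> borel_measurable borel"
    by (rule borel_measurable_continuous_onI)
  show "integrable lborel (\<lambda>x. g (f x)) \<longleftrightarrow> integrable lborel g"
    using integrable_distr_eq[of f lborel borel g] f g
    by (simp add: lborel_distr_isometric_involution[OF inv iso])
  show "(LINT x|lborel. g (f x)) = (LINT x|lborel. g x)"
    using integral_distr[of f lborel borel g] f g
    by (simp add: lborel_distr_isometric_involution[OF inv iso])
qed

section \<open>Reflection in a hyperplane\<close>

text \<open>
  For a unit vector \<open>e\<close> this is the reflection in the hyperplane of all \<open>x\<close> with \<open>x \<bullet> e = l\<close>.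
\<close>

definition reflect :: "'a::real_inner \<Rightarrow> real \<Rightarrow> 'a \<Rightarrow> 'a" where
  "reflect e l x = x - (2 * (x \<bullet> e - l)) *\<^sub>R e"

lemma reflect_inner: "norm e = 1 \<Longrightarrow> reflect e l x \<bullet> e = 2 * l - x \<bullet> e"
  by (simp add: reflect_def inner_diff_left dot_square_norm)

lemma reflect_involutive: "norm e = 1 \<Longrightarrow> reflect e l (reflect e l x) = x"
  unfolding reflect_def[of e l "reflect e l x"] reflect_inner
  by (simp add: reflect_def algebra_simps)

text \<open>
  The correction term is positive when \<open>x\<close> and \<open>y\<close> lie strictly on the same side of the plane: then
  \<open>x\<close> is closer to \<open>y\<close> than to the mirror image of \<open>y\<close>. All sign arguments below rest on this.
\<close>

lemma dist_reflect_power2: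
  assumes "norm e = 1"
  shows "(dist x (reflect e l y))\<^sup>2 = (dist x y)\<^sup>2 + 4 * (l - x \<bullet> e) * (l - y \<bullet> e)"
proof -
  define t where "t = 2 * (y \<bullet> e - l)"
  have "x - reflect e l y = (x - y) + t *\<^sub>R e"
    by (simp add: reflect_def t_def)
  moreover have "(norm (z + t *\<^sub>R e))\<^sup>2 = (norm z)\<^sup>2 + 2 * t * (z \<bullet> e) + t\<^sup>2 * (e \<bullet> e)" for z
    unfolding power2_norm_eq_inner
    by (simp add: inner_add_left inner_add_right inner_commute power2_eq_square algebra_simps)
  ultimately have "(dist x (reflect e l y))\<^sup>2 = (dist x y)\<^sup>2 + 2 * t * ((x - y) \<bullet> e) + t\<^sup>2 * (e \<bullet> e)"
    unfolding dist_norm by metis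
  then show ?thesis
    using assms by (simp add: t_def inner_diff_left power2_eq_square dot_square_norm algebra_simps)
qed

lemma dist_reflect: "norm e = 1 \<Longrightarrow> dist (reflect e l x) (reflect e l y) = dist x y"
proof -
  assume e: "norm e = 1"
  have "(dist (reflect e l x) (reflect e l y))\<^sup>2 = (dist x y)\<^sup>2"
    unfolding dist_reflect_power2[OF e, of _ l y] reflect_inner[OF e]
    using dist_reflect_power2[OF e, of y l x] by (simp add: dist_commute algebra_simps)
  then show ?thesis by simp
qed

lemma continuous_reflect [continuous_intros]:
  "continuous_on S f \<Longrightarrow> continuous_on S g \<Longrightarrow> continuous_on S (\<lambda>x. reflect e (f x) (g x))"
  unfolding reflect_def by (intro continuous_intros)

section \<open>Integrability of powers of the distance\<close>

text \<open>
  On the shell at scale \<open>\<rho> = c ^ k * b\<close> the integrand is comparable to \<open>\<rho> powr (- \<gamma>)\<close>, and the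
  volume is at most a multiple of \<open>\<rho> ^ DIM('a)\<close>. The shells therefore contribute a geometric
  series with ratio \<open>c powr (DIM('a) - \<gamma>)\<close>. Taking \<open>c = 2\<close> covers the outside of a ball, and
  \<open>c = 1/2\<close> covers its inside.
\<close>

lemma integrable_power_on_dyadic_shells:
  fixes x :: "'a::euclidean_space" and \<gamma> :: real
  assumes "b > 0" "c > 0" "c powr (DIM('a) - \<gamma>) < 1"
  defines "S \<equiv> \<lambda>k::nat. {y. c ^ k * b \<le> norm (x - y) \<and> norm (x - y) < 2 * (c ^ k * b)}"
  shows "set_integrable lborel (\<Union>k. S k) (\<lambda>y. 1 / norm (x - y) powr \<gamma>)"
proof -
  define f where "f = (\<lambda>y. 1 / norm (x - y) powr \<gamma>)"
  define V where "V = unit_ball_vol DIM('a)"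
  define q where "q = c powr (DIM('a) - \<gamma>)"
  define M where "M = V * 2 ^ DIM('a) * 2 powr \<bar>\<gamma>\<bar> * b powr (DIM('a) - \<gamma>)"
  have [measurable]: "f \<in> borel_measurable borel" unfolding f_def by measurable
  have [measurable]: "S k \<in> sets borel" for k unfolding S_def by measurable
  have V: "V \<ge> 0" by (simp add: V_def)
  have shell: "(\<integral>\<^sup>+y. ennreal (f y) * indicator (S k) y \<partial>lborel) \<le> ennreal (M * q ^ k)" for k
  proof -
    define \<rho> where "\<rho> = c ^ k * b"
    have \<rho>: "\<rho> > 0" using assms by (simp add: \<rho>_def)
    have f_le: "f y \<le> 2 powr \<bar>\<gamma>\<bar> * \<rho> powr (- \<gamma>)" if "y \<in> S k" for y
    proof -
      have y: "\<rho> \<le> norm (x - y)" "norm (x - y) < 2 * \<rho>" using that by (auto simp: S_def \<rho>_def)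
      define t where "t = norm (x - y) / \<rho>"
      have t: "1 \<le> t" "t \<le> 2" using y \<rho> by (auto simp: t_def field_simps)
      have "f y = t powr (- \<gamma>) * \<rho> powr (- \<gamma>)"
        using \<rho> t by (subst powr_mult[symmetric]) (auto simp: t_def f_def powr_minus_divide)
      moreover have "t powr (- \<gamma>) \<le> 2 powr \<bar>\<gamma>\<bar>"
      proof -
        have "t powr (- \<gamma>) \<le> t powr \<bar>\<gamma>\<bar>" using t by (intro powr_mono) auto
        also have "\<dots> \<le> 2 powr \<bar>\<gamma>\<bar>" using t by (intro powr_mono2) auto
        finally show ?thesis .
      qed
      ultimately show ?thesis by (simp add: mult_right_mono)
    qed
    have "(\<integral>\<^sup>+y. ennreal (f y) * indicator (S k) y \<partial>lborel)
        \<le> (\<integral>\<^sup>+y. ennreal (2 powr \<bar>\<gamma>\<bar> * \<rho> powr (- \<gamma>)) * indicator (S k) y \<partial>lborel)"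
      by (intro nn_integral_mono) (auto intro!: ennreal_leI f_le split: split_indicator)
    also have "\<dots> = ennreal (2 powr \<bar>\<gamma>\<bar> * \<rho> powr (- \<gamma>)) * emeasure lborel (S k)"
      by (intro nn_integral_cmult_indicator) simp
    also have "\<dots> \<le> ennreal (2 powr \<bar>\<gamma>\<bar> * \<rho> powr (- \<gamma>)) * emeasure lborel (ball x (2 * \<rho>))"
      by (intro mult_left_mono emeasure_mono) (auto simp: S_def \<rho>_def dist_norm)
    also have "\<dots> = ennreal (2 powr \<bar>\<gamma>\<bar> * \<rho> powr (- \<gamma>) * (V * (2 * \<rho>) ^ DIM('a)))"
      using \<rho> V by (simp add: emeasure_ball V_def ennreal_mult)
    also have "2 powr \<bar>\<gamma>\<bar> * \<rho> powr (- \<gamma>) * (V * (2 * \<rho>) ^ DIM('a)) = M * q ^ k"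
    proof -
      have "\<rho> powr (- \<gamma>) * \<rho> ^ DIM('a) = \<rho> powr (DIM('a) - \<gamma>)"
        using \<rho> by (simp add: powr_realpow[symmetric] powr_add[symmetric])
      also have "\<dots> = q ^ k * b powr (DIM('a) - \<gamma>)"
        using assms by (simp add: \<rho>_def q_def powr_mult powr_realpow[symmetric] powr_powr mult.commute)
      finally show ?thesis by (simp add: M_def power_mult_distrib mult_ac)
    qed
    finally show ?thesis .
  qed
  have "emeasure (density lborel (\<lambda>y. ennreal (f y))) (\<Union>k. S k)
      \<le> (\<Sum>k. emeasure (density lborel (\<lambda>y. ennreal (f y))) (S k))"
    by (intro emeasure_subadditive_countably) auto
  also have "\<dots> \<le> (\<Sum>k. ennreal (M * q ^ k))"
    using shell by (intro suminf_le) (auto simp: emeasure_density)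
  also have "\<dots> < \<infinity>"
  proof -
    have "summable (\<lambda>k. M * q ^ k)"
      using assms by (intro summable_mult summable_geometric) (auto simp: q_def)
    then show ?thesis
      using V by (subst suminf_ennreal2) (auto simp: M_def q_def)
  qed
  finally have "(\<integral>\<^sup>+y. ennreal (f y) * indicator (\<Union>k. S k) y \<partial>lborel) < \<infinity>"
    by (simp add: emeasure_density)
  then have "(\<integral>\<^sup>+y. ennreal (indicator (\<Union>k. S k) y *\<^sub>R f y) \<partial>lborel) < \<infinity>"
    by (simp add: mult.commute[of _ "indicator _ _"] indicator_mult_ennreal)
  then show ?thesis
    unfolding set_integrable_def f_def[symmetric]
    by (intro integrableI_nonneg) (auto simp: f_def)
qed

lemma ex_dyadic_scale:
  fixes t :: real
  assumes "t \<ge> 1"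
  shows "\<exists>k::nat. 2 ^ k \<le> t \<and> t < 2 * 2 ^ k"
proof -
  define k where "k = nat \<lfloor>log 2 t\<rfloor>"
  have l: "log 2 t \<ge> 0" using assms by simp
  have "2 powr real k \<le> t" "t < 2 powr (real k + 1)"
    using assms l by (auto simp: k_def powr_le_iff[of 2 t] less_powr_iff le_log_iff[symmetric] log_less_iff[symmetric])
  then show ?thesis by (intro exI[of _ k]) (simp add: powr_realpow powr_add mult.commute)
qed

lemma integrable_power_outside_ball:
  fixes x :: "'a::euclidean_space" and \<gamma> :: real
  assumes "\<gamma> > DIM('a)" "r > 0"
  shows "set_integrable lborel (- ball x r) (\<lambda>y. 1 / norm (x - y) powr \<gamma>)"
proof (rule set_integrable_subset)
  show "set_integrable lborel (\<Union>k::nat. {y. 2 ^ k * r \<le> norm (x - y) \<and> norm (x - y) < 2 * (2 ^ k * r)})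
     (\<lambda>y. 1 / norm (x - y) powr \<gamma>)"
    using assms by (intro integrable_power_on_dyadic_shells) (auto simp: powr_less_one)
  show "- ball x r \<subseteq> (\<Union>k::nat. {y. 2 ^ k * r \<le> norm (x - y) \<and> norm (x - y) < 2 * (2 ^ k * r)})"
  proof
    fix y assume "y \<in> - ball x r"
    then have "1 \<le> norm (x - y) / r" using assms by (simp add: dist_norm)
    then obtain k :: nat where "2 ^ k \<le> norm (x - y) / r" "norm (x - y) / r < 2 * 2 ^ k"
      using ex_dyadic_scale by blast
    then show "y \<in> (\<Union>k::nat. {y. 2 ^ k * r \<le> norm (x - y) \<and> norm (x - y) < 2 * (2 ^ k * r)})"
      using assms by (auto simp: field_simps)
  qed
qed simp

lemma integrable_power_inside_ball:
  fixes x :: "'a::euclidean_space" and \<gamma> :: real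
  assumes "\<gamma> < DIM('a)" "r > 0"
  shows "set_integrable lborel (ball x r) (\<lambda>y. 1 / norm (x - y) powr \<gamma>)"
proof -
  have "set_integrable lborel (ball x r - {x}) (\<lambda>y. 1 / norm (x - y) powr \<gamma>)"
  proof (rule set_integrable_subset)
    let ?S = "\<lambda>k::nat. {y. (1/2) ^ k * r \<le> norm (x - y) \<and> norm (x - y) < 2 * ((1/2) ^ k * r)}"
    show "set_integrable lborel (\<Union>k. ?S k) (\<lambda>y. 1 / norm (x - y) powr \<gamma>)"
    proof (intro integrable_power_on_dyadic_shells)
      have "(1/2::real) powr (DIM('a) - \<gamma>) = 2 powr (\<gamma> - DIM('a))"
        by (simp add: powr_divide powr_minus_divide[symmetric])
      then show "(1/2::real) powr (DIM('a) - \<gamma>) < 1" using assms by (simp add: powr_less_one)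
    qed (use assms in auto)
    show "ball x r - {x} \<subseteq> (\<Union>k. ?S k)"
    proof
      fix y assume "y \<in> ball x r - {x}"
      then have y: "0 < norm (x - y)" "norm (x - y) < r" by (auto simp: dist_norm)
      then have "1 \<le> r / norm (x - y)" by simp
      then obtain k :: nat where "2 ^ k \<le> r / norm (x - y)" "r / norm (x - y) < 2 * 2 ^ k"
        using ex_dyadic_scale by blast
      \<comment> \<open>the shell \<open>?S k\<close> occurs only when \<open>r / norm (x - y)\<close> is exactly \<open>2 ^ k\<close>\<close>
      then have "y \<in> ?S (Suc k) \<or> y \<in> ?S k"
        using y assms by (auto simp: field_simps power_divide)
      then show "y \<in> (\<Union>k. ?S k)" by blast
    qed
  qed simp
  then show ?thesis
    unfolding set_integrable_def
    by (rule Bochner_Integration.integrable_cong[THEN iffD1, rotated -1]) (auto split: split_indicator)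
qed

section \<open>Existence of the principal value\<close>

text \<open>
  Away from \<open>x\<close> the kernel is dominated by the weight that defines the space \<open>L_space\<close>.
\<close>

lemma weight_comparison:
  fixes x y :: "'a::real_normed_vector"
  assumes "N > 0" "r > 0" "r \<le> norm (x - y)"
  shows "1 / norm (x - y) powr N \<le> 2 * ((1 + norm x) / r + 1) powr N / (1 + norm y powr N)"
proof -
  define M where "M = (1 + norm x) / r + 1"
  have M: "M > 0" using assms by (simp add: M_def add_nonneg_pos)
  have pos: "norm (x - y) > 0" using assms by linarith
  have "1 + norm y \<le> 1 + norm x + norm (x - y)"
    using norm_triangle_ineq4[of x "x - y"] by simp
  also have "1 + norm x \<le> (1 + norm x) / r * norm (x - y)"
    using mult_left_mono[of 1 "norm (x - y) / r" "1 + norm x"] assms by simp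
  finally have le: "1 + norm y \<le> M * norm (x - y)"
    by (simp add: M_def algebra_simps)
  have "1 + norm y powr N \<le> 2 * (1 + norm y) powr N"
  proof -
    have "norm y powr N \<le> (1 + norm y) powr N" using assms by (intro powr_mono2) auto
    moreover have "1 \<le> (1 + norm y) powr N" using assms by (intro ge_one_powr_ge_zero) auto
    ultimately show ?thesis by simp
  qed
  also have "\<dots> \<le> 2 * (M * norm (x - y)) powr N"
    using le assms by (intro mult_left_mono powr_mono2) auto
  also have "\<dots> = 2 * M powr N * norm (x - y) powr N" using M by (simp add: powr_mult)
  finally have "(1 + norm y powr N) / norm (x - y) powr N \<le> 2 * M powr N"
    using pos by (simp add: divide_le_eq)
  moreover have "1 + norm y powr N > 0" by (simp add: add_pos_nonneg)
  ultimately show ?thesis using pos unfolding M_def[symmetric] by (simp add: field_simps)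
qed

lemma integrable_difference_quotient_outside_ball:
  fixes u :: "'a::euclidean_space \<Rightarrow> real"
  assumes u: "continuous_on UNIV u"
    and w: "integrable lborel (\<lambda>y. \<bar>u y\<bar> / (1 + norm y powr N))"
    and N: "N > DIM('a)" and r: "r > 0"
  shows "set_integrable lborel (- ball x r) (\<lambda>y. (c - u y) / norm (x - y) powr N)"
proof -
  have [measurable]: "u \<in> borel_measurable borel" using u by (rule borel_measurable_continuous_onI)
  have N0: "N > 0" using N by (smt (verit) of_nat_0_le_iff)
  define M where "M = 2 * ((1 + norm x) / r + 1) powr N"
  have "set_integrable lborel (- ball x r) (\<lambda>y. u y / norm (x - y) powr N)"
    unfolding set_integrable_def
  proof (rule Bochner_Integration.integrable_bound)
    show "integrable lborel (\<lambda>y. M * (\<bar>u y\<bar> / (1 + norm y powr N)))"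
      using w by (rule integrable_mult_right)
    show "AE y in lborel. norm (indicator (- ball x r) y *\<^sub>R (u y / norm (x - y) powr N))
        \<le> norm (M * (\<bar>u y\<bar> / (1 + norm y powr N)))"
    proof (rule AE_I2)
      fix y
      have M: "M \<ge> 0" by (simp add: M_def)
      show "norm (indicator (- ball x r) y *\<^sub>R (u y / norm (x - y) powr N))
        \<le> norm (M * (\<bar>u y\<bar> / (1 + norm y powr N)))"
      proof (cases "y \<in> ball x r")
        case False
        then have "1 / norm (x - y) powr N \<le> M / (1 + norm y powr N)"
          unfolding M_def using N0 r by (intro weight_comparison) (auto simp: dist_norm)
        from mult_left_mono[OF this, of "\<bar>u y\<bar>"] False M show ?thesis
          by (simp add: abs_mult mult.commute add_nonneg_nonneg)
      qed simp
    qed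
  qed measurable
  moreover have "set_integrable lborel (- ball x r) (\<lambda>y. c * (1 / norm (x - y) powr N))"
    by (rule set_integrable_mult_right) (rule integrable_power_outside_ball[OF N r])
  ultimately have "set_integrable lborel (- ball x r) (\<lambda>y. c * (1 / norm (x - y) powr N) - u y / norm (x - y) powr N)"
    by (rule set_integral_diff(1)[rotated])
  then show ?thesis by (simp add: diff_divide_distrib)
qed

text \<open>
  A Lipschitz gradient makes the symmetric second difference quadratically small. This is what
  compensates the singularity of the kernel, because the exponent then drops from \<open>DIM('a) + \<alpha>\<close> to
  \<open>DIM('a) + \<alpha> - 2\<close>, which is less than the dimension.
\<close>

lemma symmetric_second_difference_le:
  fixes u :: "'a::euclidean_space \<Rightarrow> real"
  assumes g: "\<And>y. GDERIV u y :> g y"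
    and lip: "K-lipschitz_on (ball x r) g" and y: "y \<in> ball x r"
  shows "\<bar>2 * u x - u y - u (2 *\<^sub>R x - y)\<bar> \<le> 2 * K * (norm (x - y))\<^sup>2"
proof -
  define z where "z = y - x"
  define \<phi> where "\<phi> = (\<lambda>t. u (x + t *\<^sub>R z) + u (x - t *\<^sub>R z))"
  define \<phi>' where "\<phi>' = (\<lambda>t. z \<bullet> g (x + t *\<^sub>R z) - z \<bullet> g (x - t *\<^sub>R z))"
  have d: "(\<phi> has_real_derivative \<phi>' t) (at t)" for t
  proof -
    have "((\<lambda>t. u (x + t *\<^sub>R z)) has_derivative (\<lambda>h. (h *\<^sub>R z) \<bullet> g (x + t *\<^sub>R z))) (at t)"
      using g[of "x + t *\<^sub>R z"] unfolding gderiv_def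
      by (rule has_derivative_compose[rotated]) (auto intro!: derivative_eq_intros)
    moreover have "((\<lambda>t. u (x - t *\<^sub>R z)) has_derivative (\<lambda>h. (- (h *\<^sub>R z)) \<bullet> g (x - t *\<^sub>R z))) (at t)"
      using g[of "x - t *\<^sub>R z"] unfolding gderiv_def
      by (rule has_derivative_compose[rotated]) (auto intro!: derivative_eq_intros)
    ultimately have "(\<phi> has_derivative (\<lambda>h. (h *\<^sub>R z) \<bullet> g (x + t *\<^sub>R z) + (- (h *\<^sub>R z)) \<bullet> g (x - t *\<^sub>R z))) (at t)"
      unfolding \<phi>_def by (rule has_derivative_add)
    then show ?thesis
      unfolding has_field_derivative_def
      by (rule has_derivative_eq_rhs) (auto simp: \<phi>'_def algebra_simps)
  qed
  obtain t where t: "0 < t" "t < 1" "\<phi> 1 - \<phi> 0 = (1 - 0) * \<phi>' t"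
    using MVT2[of 0 1 \<phi> \<phi>'] d by auto
  have n: "norm z < r" using y by (simp add: z_def dist_norm norm_minus_commute)
  have tz: "norm (t *\<^sub>R z) < r"
    using t n by (smt (verit) norm_scaleR mult_left_le_one_le norm_ge_zero)
  have "\<bar>\<phi>' t\<bar> = \<bar>z \<bullet> (g (x + t *\<^sub>R z) - g (x - t *\<^sub>R z))\<bar>"
    by (simp add: \<phi>'_def inner_diff_right)
  also have "\<dots> \<le> norm z * norm (g (x + t *\<^sub>R z) - g (x - t *\<^sub>R z))"
    by (rule Cauchy_Schwarz_ineq2)
  also have "\<dots> \<le> norm z * (K * dist (x + t *\<^sub>R z) (x - t *\<^sub>R z))"
    using lipschitz_onD[OF lip, of "x + t *\<^sub>R z" "x - t *\<^sub>R z"] tz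
    by (intro mult_left_mono) (auto simp: dist_norm)
  also have "dist (x + t *\<^sub>R z) (x - t *\<^sub>R z) = 2 * t * norm z"
  proof -
    have "x + t *\<^sub>R z - (x - t *\<^sub>R z) = (2 * t) *\<^sub>R z" by (simp add: algebra_simps scaleR_2[symmetric])
    then show ?thesis using t by (simp add: dist_norm)
  qed
  also have "norm z * (K * (2 * t * norm z)) = (2 * K * (norm z)\<^sup>2) * t"
    by (simp add: power2_eq_square)
  also have "\<dots> \<le> 2 * K * (norm z)\<^sup>2"
    using t lipschitz_on_nonneg[OF lip] by (intro mult_left_le) auto
  finally have "\<bar>\<phi> 1 - \<phi> 0\<bar> \<le> 2 * K * (norm z)\<^sup>2" using t by simp
  moreover have "\<phi> 1 - \<phi> 0 = - (2 * u x - u y - u (2 *\<^sub>R x - y))"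
    by (simp add: \<phi>_def z_def scaleR_2 algebra_simps)
  ultimately show ?thesis by (simp add: z_def norm_minus_commute abs_minus_commute)
qed

definition truncated_integral :: "real \<Rightarrow> ('a::euclidean_space \<Rightarrow> real) \<Rightarrow> 'a \<Rightarrow> real \<Rightarrow> real" where
  "truncated_integral N u x \<epsilon> = (LINT y:(- ball x \<epsilon>)|lborel. (u x - u y) / norm (x - y) powr N)"

text \<open>
  The complement of \<open>ball x \<epsilon>\<close> is invariant under the point reflection in \<open>x\<close>; averaging the integrand
  with its reflected copy turns first differences into second differences.
\<close>

lemma truncated_integral_symmetrized:
  fixes u :: "'a::euclidean_space \<Rightarrow> real"
  assumes u: "continuous_on UNIV u"
    and w: "integrable lborel (\<lambda>y. \<bar>u y\<bar> / (1 + norm y powr N))"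
    and N: "N > DIM('a)" and \<epsilon>: "\<epsilon> > 0"
  shows "set_integrable lborel (- ball x \<epsilon>) (\<lambda>y. (2 * u x - u y - u (2 *\<^sub>R x - y)) / norm (x - y) powr N)"
    and "(LINT y:(- ball x \<epsilon>)|lborel. (2 * u x - u y - u (2 *\<^sub>R x - y)) / norm (x - y) powr N)
      = 2 * truncated_integral N u x \<epsilon>"
proof -
  have [measurable]: "u \<in> borel_measurable borel" using u by (rule borel_measurable_continuous_onI)
  define f where "f = (\<lambda>y. indicator (- ball x \<epsilon>) y *\<^sub>R ((u x - u y) / norm (x - y) powr N))"
  have f_int: "integrable lborel f"
    using integrable_difference_quotient_outside_ball[OF u w N \<epsilon>]
    by (simp add: f_def set_integrable_def)
  have inv: "2 *\<^sub>R x - (2 *\<^sub>R x - y) = y" for y by simp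
  have iso: "dist (2 *\<^sub>R x - y) (2 *\<^sub>R x - z) = dist y z" for y z
    by (simp add: dist_norm norm_minus_commute)
  have [measurable]: "f \<in> borel_measurable borel" unfolding f_def by measurable
  have n: "norm (x - (2 *\<^sub>R x - y)) = norm (x - y)" for y
    by (metis add_diff_cancel_left' diff_diff_eq2 norm_minus_commute scaleR_2 diff_add_eq)
  have eq: "indicator (- ball x \<epsilon>) y *\<^sub>R ((2 * u x - u y - u (2 *\<^sub>R x - y)) / norm (x - y) powr N)
      = f y + f (2 *\<^sub>R x - y)" for y
    unfolding f_def n by (auto simp: dist_norm n add_divide_distrib[symmetric] split: split_indicator)
  have int': "integrable lborel (\<lambda>y. f (2 *\<^sub>R x - y))" 
    using integral_isometric_involution(1)[of "\<lambda>y. 2 *\<^sub>R x - y" f, OF inv iso] f_int by simp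
  show "set_integrable lborel (- ball x \<epsilon>) (\<lambda>y. (2 * u x - u y - u (2 *\<^sub>R x - y)) / norm (x - y) powr N)"
    unfolding set_integrable_def eq using int' f_int by simp
  have "(LINT y:(- ball x \<epsilon>)|lborel. (2 * u x - u y - u (2 *\<^sub>R x - y)) / norm (x - y) powr N)
     = integral\<^sup>L lborel f + (LINT y|lborel. f (2 *\<^sub>R x - y))"
    unfolding set_lebesgue_integral_def eq using int' f_int by simp
  also have "(LINT y|lborel. f (2 *\<^sub>R x - y)) = integral\<^sup>L lborel f"
    using integral_isometric_involution(2)[of "\<lambda>y. 2 *\<^sub>R x - y" f, OF inv iso] by simp
  finally show "(LINT y:(- ball x \<epsilon>)|lborel. (2 * u x - u y - u (2 *\<^sub>R x - y)) / norm (x - y) powr N)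
      = 2 * truncated_integral N u x \<epsilon>"
    by (simp add: truncated_integral_def f_def set_lebesgue_integral_def)
qed

text \<open>
  After symmetrization the integrand is absolutely integrable on the whole space, so the truncated
  integrals converge by dominated convergence.
\<close>

lemma truncated_integral_converges:
  fixes u :: "'a::euclidean_space \<Rightarrow> real"
  assumes u: "continuous_on UNIV u"
    and w: "integrable lborel (\<lambda>y. \<bar>u y\<bar> / (1 + norm y powr N))"
    and N: "N > DIM('a)" "N < DIM('a) + 2"
    and g: "\<And>y. GDERIV u y :> g y"
    and lip: "K-lipschitz_on (ball x r) g" and r: "r > 0"
  shows "\<exists>L. (truncated_integral N u x \<longlongrightarrow> L) (at_right 0)"
proof -
  have [measurable]: "u \<in> borel_measurable borel" using u by (rule borel_measurable_continuous_onI)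
  define h where "h = (\<lambda>y. (2 * u x - u y - u (2 *\<^sub>R x - y)) / norm (x - y) powr N)"
  have [measurable]: "h \<in> borel_measurable borel" unfolding h_def by measurable
  have "set_integrable lborel (ball x r) h"
  proof (rule set_integrable_bound)
    show "set_integrable lborel (ball x r) (\<lambda>y. 2 * K * (1 / norm (x - y) powr (N - 2)))"
      using N r by (intro set_integrable_mult_right integrable_power_inside_ball) auto
    show "set_borel_measurable lborel (ball x r) h"
      unfolding set_borel_measurable_def
      by (intro borel_measurable_scaleR borel_measurable_indicator) auto
    have "\<bar>h y\<bar> \<le> 2 * K * (1 / norm (x - y) powr (N - 2))" if "y \<in> ball x r" for y
    proof (cases "y = x")
      \<comment> \<open>at \<open>y = x\<close> both sides are \<open>0\<close>, since division by zero yields zero\<close>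
      case False
      then have p: "norm (x - y) > 0" by simp
      have "\<bar>h y\<bar> \<le> 2 * K * (norm (x - y))\<^sup>2 / norm (x - y) powr N"
        using symmetric_second_difference_le[OF g lip that]
        by (simp add: h_def abs_divide divide_right_mono)
      also have "2 * K * (norm (x - y))\<^sup>2 / norm (x - y) powr N = 2 * K * (1 / norm (x - y) powr (N - 2))"
        using p by (simp add: powr_diff powr_numeral)
      finally show ?thesis by simp
    qed (simp add: h_def)
    then show "AE y in lborel. y \<in> ball x r \<longrightarrow> norm (h y) \<le> norm (2 * K * (1 / norm (x - y) powr (N - 2)))"
      using lipschitz_on_nonneg[OF lip] by (intro AE_I2) (auto simp: abs_mult)
  qed
  moreover have "set_integrable lborel (- ball x r) h"
    unfolding h_def by (rule truncated_integral_symmetrized(1)[OF u w N(1) r])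
  ultimately have "set_integrable lborel (ball x r \<union> - ball x r) h"
    by (rule set_integrable_Un) auto
  then have int: "set_integrable lborel S h" if "S \<in> sets borel" for S
    by (rule set_integrable_subset) (use that in auto)
  have "((\<lambda>\<epsilon>. LINT y:(- ball x \<epsilon>)|lborel. h y) \<longlongrightarrow> (LINT y:(-{x})|lborel. h y)) (at_right 0)"
  proof (rule tendsto_at_right_sequentially[of 0 1])
    fix S :: "nat \<Rightarrow> real"
    assume S: "\<And>n. 0 < S n" "decseq S" "S \<longlonglongrightarrow> 0"
    have U: "(\<Union>n. - ball x (S n)) = - {x}"
    proof (intro set_eqI iffI)
      fix y assume "y \<in> - {x}"
      then have "eventually (\<lambda>n. S n < dist x y) sequentially"
        using S(3) by (intro order_tendstoD) auto
      then obtain n where "S n < dist x y" by (auto simp: eventually_sequentially)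
      then show "y \<in> (\<Union>n. - ball x (S n))" by (auto intro!: exI[of _ n])
    qed (use S in auto)
    have "(\<lambda>n. LINT y:(- ball x (S n))|lborel. h y) \<longlonglongrightarrow> (LINT y:(\<Union>n. - ball x (S n))|lborel. h y)"
    proof (rule set_integral_cont_up)
      show "incseq (\<lambda>n. - ball x (S n))"
        using S(2) by (force simp: incseq_def decseq_def)
    qed (auto simp: U intro: int)
    then show "(\<lambda>n. LINT y:(- ball x (S n))|lborel. h y) \<longlonglongrightarrow> (LINT y:(-{x})|lborel. h y)"
      unfolding U .
  qed simp
  then have "((\<lambda>\<epsilon>. (LINT y:(- ball x \<epsilon>)|lborel. h y) / 2) \<longlongrightarrow> (LINT y:(-{x})|lborel. h y) / 2) (at_right 0)"
    by (intro tendsto_intros) auto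
  moreover have "\<forall>\<^sub>F \<epsilon> in at_right 0. (LINT y:(- ball x \<epsilon>)|lborel. h y) / 2 = truncated_integral N u x \<epsilon>"
    using eventually_at_right_less[of "0::real"]
    by eventually_elim (simp add: h_def truncated_integral_symmetrized(2)[OF u w N(1)])
  ultimately show ?thesis
    by (intro exI) (rule tendsto_cong[THEN iffD1])
qed

lemma C11_loc_continuous: "u \<in> C11_loc \<Longrightarrow> continuous_on UNIV u"
  unfolding C11_loc_def gderiv_def
  using has_derivative_continuous by (fastforce intro: continuous_at_imp_continuous_on)

lemma L_space_integrable_lborel:
  fixes u :: "real ^ 'n \<Rightarrow> real"
  assumes u: "u \<in> L_space \<alpha> \<inter> C11_loc"
  shows "integrable lborel (\<lambda>y. \<bar>u y\<bar> / (1 + norm y powr (real CARD('n) + \<alpha>)))"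
proof -
  have "continuous_on UNIV u" using u C11_loc_continuous by blast
  then have [measurable]: "u \<in> borel_measurable borel" by (rule borel_measurable_continuous_onI)
  have "integrable lebesgue (\<lambda>y. \<bar>u y\<bar> / (1 + norm y powr (real CARD('n) + \<alpha>)))"
    using u by (simp add: L_space_def)
  then show ?thesis by (subst (asm) integrable_completion) auto
qed

lemma truncated_integral_tendsto_frac_laplacian:
  fixes u :: "real ^ 'n \<Rightarrow> real"
  assumes "C > 0" "0 < \<alpha>" "\<alpha> < 2" and u: "u \<in> L_space \<alpha> \<inter> C11_loc"
  shows "(truncated_integral (real CARD('n) + \<alpha>) u x \<longlongrightarrow> frac_laplacian C \<alpha> u x / C) (at_right 0)"
proof -
  let ?N = "real CARD('n) + \<alpha>"
  have c: "continuous_on UNIV u" using u C11_loc_continuous by blast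
  then have [measurable]: "u \<in> borel_measurable borel" by (rule borel_measurable_continuous_onI)
  note w = L_space_integrable_lborel[OF u]
  obtain g where g: "\<And>y. GDERIV u y :> g y" and "\<forall>x. \<exists>r>0. \<exists>K. K-lipschitz_on (ball x r) g"
    using u by (auto simp: C11_loc_def)
  then obtain r K where r: "r > 0" and lip: "K-lipschitz_on (ball x r) g" by blast
  have "\<exists>L. (truncated_integral ?N u x \<longlongrightarrow> L) (at_right 0)"
    by (rule truncated_integral_converges[OF c w _ _ g lip r]) (use assms in auto)
  then obtain L where L: "(truncated_integral ?N u x \<longlongrightarrow> L) (at_right 0)" ..
  have "(LINT y:(- ball x \<epsilon>)|lebesgue. (u x - u y) / norm (x - y) powr ?N) = truncated_integral ?N u x \<epsilon>" for \<epsilon>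
    unfolding truncated_integral_def set_lebesgue_integral_def by (rule integral_completion) measurable
  then have "frac_laplacian C \<alpha> u x = C * L"
    using L unfolding frac_laplacian_def by (simp add: tendsto_Lim)
  then show ?thesis using L assms by simp
qed

section \<open>The operator applied to a reflection gap\<close>

definition reflection_gap :: "('a::real_inner \<Rightarrow> real) \<Rightarrow> 'a \<Rightarrow> real \<Rightarrow> 'a \<Rightarrow> real" where
  "reflection_gap u e l y = u (reflect e l y) - u y"

lemma reflection_gap_reflect:
  "norm e = 1 \<Longrightarrow> reflection_gap u e l (reflect e l y) = - reflection_gap u e l y"
  by (simp add: reflection_gap_def reflect_involutive)

lemma reflection_gap_on_plane: "y \<bullet> e = l \<Longrightarrow> reflection_gap u e l y = 0"
  by (simp add: reflection_gap_def reflect_def)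

text \<open>
  Here \<open>L\<close> is the fractional Laplacian of \<open>u\<close> without its normalization constant, and \<open>N\<close> stands for
  \<open>n + \<alpha>\<close>.
\<close>

locale nonlocal_operator =
  fixes N :: real and u L :: "'a::euclidean_space \<Rightarrow> real"
  assumes N: "N > DIM('a)"
    and continuous: "continuous_on UNIV u"
    and weighted_integrable: "integrable lborel (\<lambda>y. \<bar>u y\<bar> / (1 + norm y powr N))"
    and limit: "\<And>x. (truncated_integral N u x \<longlongrightarrow> L x) (at_right 0)"
begin

lemma N_pos: "N > 0"
  using N by (smt (verit) of_nat_0_le_iff)

lemma continuous_reflection_gap: "continuous_on UNIV (reflection_gap u e l)"
  unfolding reflection_gap_def
  by (intro continuous_intros continuous_on_compose2[OF continuous]) auto

lemma measurable_reflection_gap [measurable]: "reflection_gap u e l \<in> borel_measurable borel"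
  by (rule borel_measurable_continuous_onI[OF continuous_reflection_gap])

text \<open>
  Since the reflection preserves both the measure and the distance, evaluating the operator at the
  mirror image of \<open>x\<close>, with the same truncation, amounts to evaluating it at \<open>x\<close> for the reflected function. Hence the difference
  of the two values is the operator applied to the gap.
\<close>

lemma truncated_integral_reflect:
  fixes e x :: 'a and l \<epsilon> :: real
  assumes e: "norm e = 1" and \<epsilon>: "\<epsilon> > 0"
  defines "F \<equiv> \<lambda>y. indicator (- ball x \<epsilon>) y *
      ((reflection_gap u e l x - reflection_gap u e l y) * (1 / norm (x - y) powr N))"
  shows "integrable lborel F"
    and "truncated_integral N u (reflect e l x) \<epsilon> - truncated_integral N u x \<epsilon> = integral\<^sup>L lborel F"
proof -
  have [measurable]: "u \<in> borel_measurable borel" using continuous by (rule borel_measurable_continuous_onI)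
  define f where "f = (\<lambda>z y. indicator (- ball z \<epsilon>) y *\<^sub>R ((u z - u y) / norm (z - y) powr N))"
  have [measurable]: "f z \<in> borel_measurable borel" for z unfolding f_def by measurable
  have f_int: "integrable lborel (f z)" for z
    using integrable_difference_quotient_outside_ball[OF continuous weighted_integrable N \<epsilon>]
    by (simp add: f_def set_integrable_def)
  have tr: "truncated_integral N u z \<epsilon> = integral\<^sup>L lborel (f z)" for z
    by (simp add: truncated_integral_def f_def set_lebesgue_integral_def)
  note R = reflect_involutive[OF e] dist_reflect[OF e]
  have F_eq: "F y = f (reflect e l x) (reflect e l y) - f x y" for y
    using R(2)[of l x y]
    by (auto simp: F_def f_def R dist_norm reflection_gap_def diff_divide_distrib add_divide_distrib split: split_indicator)
  have int: "integrable lborel (\<lambda>y. f (reflect e l x) (reflect e l y))"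
    using integral_isometric_involution(1)[of "reflect e l" "f (reflect e l x)", OF R] f_int by simp
  show "integrable lborel F"
    unfolding F_eq using int f_int by (rule Bochner_Integration.integrable_diff)
  have "integral\<^sup>L lborel F = (LINT y|lborel. f (reflect e l x) (reflect e l y)) - integral\<^sup>L lborel (f x)"
    unfolding F_eq using int f_int by (rule Bochner_Integration.integral_diff)
  also have "(LINT y|lborel. f (reflect e l x) (reflect e l y)) = integral\<^sup>L lborel (f (reflect e l x))"
    using integral_isometric_involution(2)[of "reflect e l" "f (reflect e l x)", OF R] by simp
  finally show "truncated_integral N u (reflect e l x) \<epsilon> - truncated_integral N u x \<epsilon> = integral\<^sup>L lborel F"
    by (simp add: tr)
qed

lemma kernel_reflect_le:
  assumes "norm e = 1" "x \<bullet> e < l" "y \<bullet> e < l" "x \<noteq> y"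
  shows "1 / norm (x - reflect e l y) powr N < 1 / norm (x - y) powr N"
proof -
  have "(dist x y)\<^sup>2 < (dist x (reflect e l y))\<^sup>2"
    using assms by (simp add: dist_reflect_power2)
  then have "norm (x - y) < norm (x - reflect e l y)"
    unfolding dist_norm by (rule power_less_imp_less_base) simp
  then have "norm (x - y) powr N < norm (x - reflect e l y) powr N"
    using N_pos by (intro powr_less_mono2) auto
  moreover have "0 < norm (x - y) powr N" using assms by simp
  ultimately show ?thesis by (intro divide_strict_left_mono mult_pos_pos) linarith+
qed

text \<open>
  Write \<open>k\<close> for the kernel with pole \<open>x\<close> and \<open>k'\<close> for its reflected copy. The gap \<open>U\<close> is odd with
  respect to the plane, so folding the integral onto the half-space containing \<open>x\<close> gives the integrand
  \<open>(U x - U y) * k y + (U x + U y) * k' y = (U x - U y) * (k y - k' y) + 2 * U x * k' y\<close>.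
  At a nonpositive minimum both summands on the right are nonpositive, because \<open>k' \<le> k\<close>. So any ball on which the
  integrand is at most \<open>- m\<close> bounds the whole integral. Removing \<open>ball x \<epsilon>\<close> spoils the
  rearrangement only inside that ball, where \<open>k'\<close> is bounded; this error vanishes with \<open>\<epsilon>\<close>.
\<close>

lemma gap_operator_le:
  fixes e x z :: 'a and l r m :: real
  defines "U \<equiv> reflection_gap u e l"
  assumes e: "norm e = 1" and x: "x \<bullet> e < l"
    and neg: "U x \<le> 0" and min: "\<And>y. y \<bullet> e < l \<Longrightarrow> U x \<le> U y"
    and z: "\<And>y. y \<in> ball z r \<Longrightarrow> y \<bullet> e < l" and r: "r < dist x z"
    and m: "m \<ge> 0"
      "\<And>y. y \<in> ball z r \<Longrightarrow>
        (U x - U y) * (1 / norm (x - y) powr N - 1 / norm (x - reflect e l y) powr N)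
          + 2 * U x * (1 / norm (x - reflect e l y) powr N) \<le> - m"
  shows "L (reflect e l x) - L x \<le> - m * measure lborel (ball z r)"
proof -
  define \<delta> where "\<delta> = l - x \<bullet> e"
  have \<delta>: "\<delta> > 0" using x by (simp add: \<delta>_def)
  define k where "k = (\<lambda>y. 1 / norm (x - y) powr N)"
  have k0: "k y \<ge> 0" for y by (simp add: k_def)
  have [measurable]: "U \<in> borel_measurable borel" unfolding U_def by measurable
  have U_refl: "U (reflect e l y) = - U y" for y
    unfolding U_def by (rule reflection_gap_reflect[OF e])
  obtain \<epsilon>\<^sub>1 where \<epsilon>\<^sub>1: "\<epsilon>\<^sub>1 > 0" "\<And>y. y \<in> ball x \<epsilon>\<^sub>1 \<Longrightarrow> U y < U x + 1"
  proof -
    have "isCont U x"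
      using continuous_reflection_gap[of e l] by (simp add: U_def continuous_on_eq_continuous_at)
    then have "eventually (\<lambda>y. U y < U x + 1) (nhds x)"
      by (intro order_tendstoD) (auto simp: isCont_def tendsto_at_iff_tendsto_nhds)
    then show ?thesis using that by (auto simp: eventually_nhds_metric dist_commute)
  qed
  define c where "c = 1 / \<delta> powr N"
  have est: "truncated_integral N u (reflect e l x) \<epsilon> - truncated_integral N u x \<epsilon>
      \<le> - m * measure lborel (ball z r) + c * measure lborel (ball x \<epsilon>)"
    if \<epsilon>: "0 < \<epsilon>" "\<epsilon> < \<epsilon>\<^sub>1" "\<epsilon> < \<delta>" "\<epsilon> < dist x z - r" for \<epsilon>
  proof -
    define F where "F = (\<lambda>y. indicator (- ball x \<epsilon>) y * ((U x - U y) * k y))"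
    have F: "integrable lborel F"
      "truncated_integral N u (reflect e l x) \<epsilon> - truncated_integral N u x \<epsilon> = integral\<^sup>L lborel F"
      unfolding F_def k_def U_def using truncated_integral_reflect[OF e \<epsilon>(1)] by auto
    have [measurable]: "F \<in> borel_measurable borel" unfolding F_def k_def by measurable
    have near: "y \<bullet> e < l" if "y \<in> ball x \<epsilon>" for y
    proof -
      have "(y - x) \<bullet> e \<le> norm (y - x) * norm e" by (rule norm_cauchy_schwarz)
      then show ?thesis using that e \<epsilon> by (simp add: \<delta>_def dist_norm norm_minus_commute inner_diff_left)
    qed
    \<comment> \<open>\<open>F\<close> is nonpositive on the plane itself, so that an inequality avoids showing that the plane is a null set\<close>
    define G where "G = (\<lambda>y. if y \<bullet> e > l then F y else 0)"
    define H where "H = (\<lambda>y. if y \<bullet> e < l then F y else 0)"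
    have [measurable]: "G \<in> borel_measurable borel" unfolding G_def by measurable
    have G_int: "integrable lborel G"
      by (rule Bochner_Integration.integrable_bound[OF F(1)]) (auto simp: G_def)
    have H_int: "integrable lborel H"
      by (rule Bochner_Integration.integrable_bound[OF F(1)]) (auto simp: H_def)
    note R = reflect_involutive[OF e] dist_reflect[OF e]
    have GR_int: "integrable lborel (\<lambda>y. G (reflect e l y))"
      using integral_isometric_involution(1)[of "reflect e l" G, OF R] G_int by simp
    have GR: "(LINT y|lborel. G (reflect e l y)) = integral\<^sup>L lborel G"
      using integral_isometric_involution(2)[of "reflect e l" G, OF R] by simp
    have ind: "integrable lborel (indicator (ball w s) :: 'a \<Rightarrow> real)" for w s
      using emeasure_lborel_ball_finite[of w s] by (intro integrable_real_indicator) auto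
    have "integral\<^sup>L lborel F \<le> (LINT y|lborel. H y + G y)"
    proof (rule integral_mono)
      fix y
      show "F y \<le> H y + G y"
      proof (cases "y \<bullet> e = l")
        case True
        then have "U y = 0" unfolding U_def by (rule reflection_gap_on_plane)
        then have "F y \<le> 0"
          using neg k0[of y] by (auto simp: F_def mult_nonpos_nonneg split: split_indicator)
        then show ?thesis using True by (simp add: G_def H_def)
      qed (auto simp: G_def H_def)
    qed (use F G_int H_int in auto)
    also have "\<dots> = (LINT y|lborel. H y + G (reflect e l y))"
      using GR GR_int G_int H_int by simp
    also have "\<dots> \<le> (LINT y|lborel. - m * indicator (ball z r) y + c * indicator (ball x \<epsilon>) y)"
    proof (rule integral_mono)
      fix y
      show "H y + G (reflect e l y) \<le> - m * indicator (ball z r) y + c * indicator (ball x \<epsilon>) y"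
      proof (cases "y \<bullet> e < l")
        case False
        then have "y \<notin> ball z r" "y \<notin> ball x \<epsilon>" using z near by blast+
        then show ?thesis using False by (simp add: H_def G_def reflect_inner[OF e])
      next
        case True
        have "reflect e l y \<notin> ball x \<epsilon>"
          using near[of "reflect e l y"] True by (auto simp: reflect_inner[OF e])
        then have G: "G (reflect e l y) = (U x + U y) * k (reflect e l y)"
          using True by (simp add: G_def F_def reflect_inner[OF e] U_refl)
        show ?thesis
        proof (cases "y \<in> ball x \<epsilon>")
          case yx: True
          \<comment> \<open>inside the removed ball only the reflected kernel contributes, and it is at most \<open>c\<close>\<close>
          have "dist x z \<le> dist x y + dist y z" by (rule dist_triangle)
          then have "y \<notin> ball z r" using yx \<epsilon> by (auto simp: dist_commute)
          have "(reflect e l y - x) \<bullet> e \<le> norm (reflect e l y - x) * norm e" by (rule norm_cauchy_schwarz)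
          then have "\<delta> \<le> norm (x - reflect e l y)"
            using True e by (simp add: \<delta>_def inner_diff_left reflect_inner[OF e] norm_minus_commute)
          moreover from this have "0 < norm (x - reflect e l y)" using \<delta> by linarith
          ultimately have "k (reflect e l y) \<le> c"
            using \<delta> N_pos unfolding k_def c_def by (intro divide_left_mono powr_mono2) auto
          moreover have "U x + U y \<le> 1" using neg \<epsilon>\<^sub>1(2)[of y] yx \<epsilon> by auto
          ultimately have "(U x + U y) * k (reflect e l y) \<le> 1 * c"
            using k0 by (intro order.trans[OF mult_right_mono mult_left_mono]) auto
          then show ?thesis using G True yx \<open>y \<notin> ball z r\<close> by (simp add: H_def F_def)
        next
          case False
          then have "x \<noteq> y" using \<epsilon> by auto
          then have kk: "k (reflect e l y) \<le> k y"
            unfolding k_def using kernel_reflect_le[OF e x True] by simp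
          have "H y + G (reflect e l y) = (U x - U y) * (k y - k (reflect e l y)) + 2 * U x * k (reflect e l y)"
            unfolding G using True False by (simp add: H_def F_def algebra_simps)
          moreover have "(U x - U y) * (k y - k (reflect e l y)) + 2 * U x * k (reflect e l y) \<le> - m" if "y \<in> ball z r"
            using m(2)[OF that] by (simp add: k_def)
          moreover have "(U x - U y) * (k y - k (reflect e l y)) + 2 * U x * k (reflect e l y) \<le> 0"
          proof (rule add_nonpos_nonpos)
            show "(U x - U y) * (k y - k (reflect e l y)) \<le> 0"
              using kk min[OF True] by (intro mult_nonpos_nonneg) auto
            show "2 * U x * k (reflect e l y) \<le> 0"
              using neg k0[of "reflect e l y"] by (simp add: mult_nonpos_nonneg)
          qed
          ultimately show ?thesis using False by (auto split: split_indicator)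
        qed
      qed
    qed (use GR_int H_int ind in auto)
    also have "\<dots> = - m * measure lborel (ball z r) + c * measure lborel (ball x \<epsilon>)"
      using ind by simp
    finally show ?thesis using F by simp
  qed
  have "((\<lambda>\<epsilon>. - m * measure lborel (ball z r) + c * measure lborel (ball x \<epsilon>))
      \<longlongrightarrow> - m * measure lborel (ball z r) + c * 0) (at_right 0)"
  proof (intro tendsto_intros)
    have "((\<lambda>\<epsilon>::real. \<epsilon> ^ DIM('a) * measure lborel (ball (0::'a) 1)) \<longlongrightarrow> 0 ^ DIM('a) * measure lborel (ball (0::'a) 1)) (at_right 0)"
      by (intro tendsto_intros)
    moreover have "\<forall>\<^sub>F \<epsilon> in at_right 0. \<epsilon> ^ DIM('a) * measure lborel (ball (0::'a) 1) = measure lborel (ball x \<epsilon>)"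
      using eventually_at_right_less[of "0::real"]
      by eventually_elim (simp add: content_ball_conv_unit_ball[of _ x])
    ultimately show "((\<lambda>\<epsilon>. measure lborel (ball x \<epsilon>)) \<longlongrightarrow> 0) (at_right 0)"
      by (simp add: tendsto_cong zero_power)
  qed
  moreover have "((\<lambda>\<epsilon>. truncated_integral N u (reflect e l x) \<epsilon> - truncated_integral N u x \<epsilon>)
      \<longlongrightarrow> L (reflect e l x) - L x) (at_right 0)"
    by (intro tendsto_intros limit)
  moreover have "\<forall>\<^sub>F \<epsilon> in at_right 0. truncated_integral N u (reflect e l x) \<epsilon> - truncated_integral N u x \<epsilon>
      \<le> - m * measure lborel (ball z r) + c * measure lborel (ball x \<epsilon>)"
  proof -
    have "\<forall>\<^sub>F \<epsilon> in at_right 0. \<epsilon> \<in> {0<..<min \<epsilon>\<^sub>1 (min \<delta> (dist x z - r))}"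
      by (rule eventually_at_right_real) (use \<epsilon>\<^sub>1 \<delta> r in auto)
    then show ?thesis by eventually_elim (rule est; simp)
  qed
  ultimately show ?thesis
    using tendsto_le[OF trivial_limit_at_right_real] by fastforce
qed

text \<open>
  The test ball lies at distance of order \<open>\<delta>\<close> from \<open>x\<close>, on the side away from the plane; there \<open>k'\<close> is at
  least \<open>(5 * \<delta>) powr (- N)\<close>. Because \<open>N - DIM('a) = \<alpha>\<close>, the resulting bound has the scaling
  \<open>\<delta> powr (- \<alpha>)\<close>. It serves at once near the plane, where it blows up, and at infinity, where it
  decays more slowly than the coefficients of the system.
\<close>

lemma gap_operator_at_negative_minimum:
  fixes e x :: 'a and l :: real
  defines "U \<equiv> reflection_gap u e l" and "\<delta> \<equiv> l - x \<bullet> e"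
  assumes e: "norm e = 1" and x: "x \<bullet> e < l"
    and neg: "U x \<le> 0" and min: "\<And>y. y \<bullet> e < l \<Longrightarrow> U x \<le> U y"
  shows "L (reflect e l x) - L x \<le> 2 * measure lborel (ball (0::'a) 1) / 5 powr N * \<delta> powr (DIM('a) - N) * U x"
proof -
  define z where "z = x - (2 * \<delta>) *\<^sub>R e"
  define m where "m = - (2 * U x / (5 * \<delta>) powr N)"
  have \<delta>: "\<delta> > 0" using x by (simp add: \<delta>_def)
  have ze: "z \<bullet> e = x \<bullet> e - 2 * \<delta>" using e by (simp add: z_def inner_diff_left dot_square_norm)
  have Rz: "reflect e l z = x + (4 * \<delta>) *\<^sub>R e"
  proof -
    have "2 * (x \<bullet> e - 2 * \<delta> - l) = - (6 * \<delta>)" by (simp add: \<delta>_def)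
    then show ?thesis
      unfolding reflect_def ze by (simp add: z_def algebra_simps flip: scaleR_add_left)
  qed
  have z: "y \<bullet> e < l" if "y \<in> ball z \<delta>" for y
  proof -
    have "(y - z) \<bullet> e \<le> norm (y - z) * norm e" by (rule norm_cauchy_schwarz)
    then show ?thesis using that e \<delta> ze
      by (simp add: \<delta>_def dist_norm norm_minus_commute inner_diff_left)
  qed
  have "L (reflect e l x) - L x \<le> - m * measure lborel (ball z \<delta>)"
  proof (rule gap_operator_le[OF e x _ _ z])
    show "reflection_gap u e l x \<le> 0" "\<And>y. y \<bullet> e < l \<Longrightarrow> reflection_gap u e l x \<le> reflection_gap u e l y"
      using neg min by (auto simp: U_def)
    show dz: "\<delta> < dist x z" using \<delta> e by (simp add: z_def dist_norm)
    show "m \<ge> 0" using neg by (simp add: m_def divide_nonpos_nonneg)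
    fix y assume y: "y \<in> ball z \<delta>"
    have "x \<noteq> y" using dz y by (auto simp: dist_commute)
    then have "(U x - U y) * (1 / norm (x - y) powr N - 1 / norm (x - reflect e l y) powr N) \<le> 0"
      using kernel_reflect_le[OF e x z[OF y]] min[OF z[OF y]] by (intro mult_nonpos_nonneg) auto
    moreover have "2 * U x * (1 / norm (x - reflect e l y) powr N) \<le> 2 * U x * (1 / (5 * \<delta>) powr N)"
    proof (rule mult_left_mono_neg)
      have "dist x (reflect e l y) \<le> dist x (reflect e l z) + dist (reflect e l z) (reflect e l y)"
        by (rule dist_triangle)
      also have "dist x (reflect e l z) = 4 * \<delta>" using \<delta> e by (simp add: Rz dist_norm)
      also have "4 * \<delta> + dist (reflect e l z) (reflect e l y) \<le> 5 * \<delta>"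
        using y by (simp add: dist_reflect[OF e])
      finally have "norm (x - reflect e l y) \<le> 5 * \<delta>" by (simp add: dist_norm)
      moreover have "norm (x - reflect e l y) > 0"
        using x z[OF y] by (auto simp: reflect_inner[OF e])
      ultimately show "1 / (5 * \<delta>) powr N \<le> 1 / norm (x - reflect e l y) powr N"
        using N_pos \<delta> by (intro divide_left_mono powr_mono2) auto
    qed (use neg in auto)
    ultimately show "(reflection_gap u e l x - reflection_gap u e l y) * (1 / norm (x - y) powr N - 1 / norm (x - reflect e l y) powr N)
          + 2 * reflection_gap u e l x * (1 / norm (x - reflect e l y) powr N) \<le> - m"
      by (simp add: U_def m_def)
  qed
  also have "measure lborel (ball z \<delta>) = \<delta> ^ DIM('a) * measure lborel (ball (0::'a) 1)"
    using \<delta> by (intro content_ball_conv_unit_ball) auto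
  also have "- m * \<dots> = 2 * measure lborel (ball (0::'a) 1) / 5 powr N * \<delta> powr (DIM('a) - N) * U x"
    using \<delta> by (simp add: m_def powr_mult powr_diff powr_realpow field_simps)
  finally show ?thesis .
qed

text \<open>
  The strong maximum principle for the gap: since \<open>k' < k\<close> strictly, a small ball around a point
  where the gap is positive already makes the folded integral negative.
\<close>

lemma gap_operator_at_zero_minimum:
  fixes e x y\<^sub>0 :: 'a and l :: real
  defines "U \<equiv> reflection_gap u e l"
  assumes e: "norm e = 1" and x: "x \<bullet> e < l"
    and zero: "U x = 0" and nonneg: "\<And>y. y \<bullet> e < l \<Longrightarrow> U y \<ge> 0"
    and y\<^sub>0: "y\<^sub>0 \<bullet> e < l" "U y\<^sub>0 \<noteq> 0"
  shows "L (reflect e l x) < L x"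
proof -
  define H where "H = (\<lambda>y. (U x - U y) * (1 / norm (x - y) powr N - 1 / norm (x - reflect e l y) powr N)
          + 2 * U x * (1 / norm (x - reflect e l y) powr N))"
  have ne: "x \<noteq> y\<^sub>0" using zero y\<^sub>0 by auto
  have ne': "x \<noteq> reflect e l y\<^sub>0" using x y\<^sub>0 by (auto simp: reflect_inner[OF e])
  have "U y\<^sub>0 > 0" using nonneg[OF y\<^sub>0(1)] y\<^sub>0 by simp
  then have "H y\<^sub>0 < 0"
    using kernel_reflect_le[OF e x y\<^sub>0(1) ne] zero by (simp add: H_def mult_neg_pos)
  have "isCont U y\<^sub>0"
    using continuous_reflection_gap[of e l] by (simp add: U_def continuous_on_eq_continuous_at)
  moreover have "isCont (reflect e l) y\<^sub>0"
    using continuous_reflect[OF continuous_on_const continuous_on_id, of UNIV e l]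
    by (simp add: continuous_on_eq_continuous_at)
  ultimately have "isCont H y\<^sub>0"
    unfolding H_def using ne ne' by (intro continuous_intros) auto
  then have "eventually (\<lambda>y. H y < H y\<^sub>0 / 2) (nhds y\<^sub>0)"
    using \<open>H y\<^sub>0 < 0\<close> by (intro order_tendstoD) (auto simp: isCont_def tendsto_at_iff_tendsto_nhds)
  moreover have "eventually (\<lambda>y. y \<bullet> e < l) (nhds y\<^sub>0)"
    using y\<^sub>0 by (intro order_tendstoD(2)[OF tendsto_inner[OF filterlim_ident tendsto_const]])
  ultimately have "eventually (\<lambda>y. H y < H y\<^sub>0 / 2 \<and> y \<bullet> e < l) (nhds y\<^sub>0)"
    by (rule eventually_conj)
  then obtain d where d: "d > 0" "\<And>y. dist y y\<^sub>0 < d \<Longrightarrow> H y < H y\<^sub>0 / 2 \<and> y \<bullet> e < l"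
    by (auto simp: eventually_nhds_metric)
  define r where "r = min d (dist x y\<^sub>0 / 2)"
  have r: "r > 0" "r < dist x y\<^sub>0" using d ne by (auto simp: r_def min_less_iff_disj)
  have "L (reflect e l x) - L x \<le> - (- H y\<^sub>0 / 2) * measure lborel (ball y\<^sub>0 r)"
  proof (rule gap_operator_le[OF e x])
    fix y assume "y \<in> ball y\<^sub>0 r"
    then have "dist y y\<^sub>0 < d" by (simp add: r_def dist_commute)
    then have "y \<bullet> e < l" "H y \<le> - (- H y\<^sub>0 / 2)" using d(2) by fastforce+
    then show "y \<bullet> e < l"
      "(reflection_gap u e l x - reflection_gap u e l y) * (1 / norm (x - y) powr N - 1 / norm (x - reflect e l y) powr N)
          + 2 * reflection_gap u e l x * (1 / norm (x - reflect e l y) powr N) \<le> - (- H y\<^sub>0 / 2)"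
      by (simp_all only: H_def U_def)
  qed (use zero nonneg r \<open>H y\<^sub>0 < 0\<close> in \<open>auto simp: U_def\<close>)
  also have "\<dots> < 0"
    using r \<open>H y\<^sub>0 < 0\<close> by (simp add: mult_neg_pos)
  finally show ?thesis by simp
qed

end

section \<open>One equation of a competitive system\<close>

lemma powr_diff_le:
  fixes s t \<beta> :: real
  assumes "0 < t" "t \<le> s" "\<beta> > 1"
  shows "s powr \<beta> - t powr \<beta> \<le> \<beta> * s powr (\<beta> - 1) * (s - t)"
proof (cases "t = s")
  case False
  then have "t < s" using assms by simp
  then obtain z where z: "t < z" "z < s" "s powr \<beta> - t powr \<beta> = (s - t) * (\<beta> * z powr (\<beta> - 1))"
    using MVT2[of t s "\<lambda>x. x powr \<beta>" "\<lambda>x. \<beta> * x powr (\<beta> - 1)"] assms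
    by (fastforce intro!: derivative_eq_intros)
  have "z powr (\<beta> - 1) \<le> s powr (\<beta> - 1)" using z assms by (intro powr_mono2) auto
  then have "(s - t) * (\<beta> * z powr (\<beta> - 1)) \<le> (s - t) * (\<beta> * s powr (\<beta> - 1))"
    using assms by (intro mult_left_mono) auto
  then show ?thesis using z by (simp add: mult_ac)
qed simp

text \<open>
  The damping term \<open>\<kappa> * u x powr p\<close> is kept as an arbitrary increasing function \<open>h\<close>. With \<open>\<alpha> = N - DIM('a)\<close>, the
  assumption on \<open>v\<close> is the decay \<open>(1 + norm x) powr (- 2 * \<alpha>)\<close> of \<open>v powr (\<beta> - 1)\<close>, which the critical exponent produces from the decay of
  \<open>v\<close>: \<open>(n - \<alpha>) * (\<beta> - 1) = 2 * \<alpha>\<close>.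
\<close>

locale competitive_equation = nonlocal_operator N u L
  for N :: real and u L :: "'a::euclidean_space \<Rightarrow> real" +
  fixes v :: "'a \<Rightarrow> real" and h :: "real \<Rightarrow> real" and a \<beta> K :: real
  assumes equation: "\<And>x. L x = a * v x powr \<beta> - h (u x)"
    and a_pos: "a > 0" and \<beta>: "\<beta> > 1"
    and u_pos: "\<And>x. u x > 0" and v_pos: "\<And>x. v x > 0"
    and h_mono: "\<And>s t. 0 < s \<Longrightarrow> s \<le> t \<Longrightarrow> h s \<le> h t"
    and u_vanishes: "(u \<longlongrightarrow> 0) at_infinity"
    and v_decay: "\<And>x. v x powr (\<beta> - 1) \<le> K * (1 + norm x) powr (- 2 * (N - DIM('a)))"
begin

text \<open>
  The numerical factor in the bound \<open>gap_operator_at_negative_minimum\<close>.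
\<close>

definition min_const :: real where
  "min_const = 2 * measure lborel (ball (0::'a) 1) / 5 powr N"

lemma min_const_pos: "min_const > 0"
  by (simp add: min_const_def)

lemma small_far_away: "\<eta> > 0 \<Longrightarrow> \<exists>\<rho>. \<forall>y. norm y \<ge> \<rho> \<longrightarrow> u y < \<eta>"
  using order_tendstoD(2)[OF u_vanishes, of \<eta>] by (simp add: eventually_at_infinity)

text \<open>
  The gap vanishes on the plane, and far away it is bounded below by minus a small number because \<open>u\<close> is
  positive and tends to zero. A negative infimum is therefore attained inside the half-space.
\<close>

lemma negative_minimum_exists:
  assumes e: "norm e = 1" and y\<^sub>0: "y\<^sub>0 \<bullet> e < l" "reflection_gap u e l y\<^sub>0 < 0"
  shows "\<exists>x. x \<bullet> e < l \<and> reflection_gap u e l x < 0 \<and>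
    (\<forall>y. y \<bullet> e < l \<longrightarrow> reflection_gap u e l x \<le> reflection_gap u e l y)"
proof -
  let ?U = "reflection_gap u e l"
  obtain \<rho> where \<rho>: "\<And>y. norm y \<ge> \<rho> \<Longrightarrow> u y < - ?U y\<^sub>0"
    using small_far_away[of "- ?U y\<^sub>0"] y\<^sub>0 by auto
  define S where "S = cball 0 (max \<rho> (norm y\<^sub>0)) \<inter> {y. e \<bullet> y \<le> l}"
  have "compact S" unfolding S_def by (intro compact_Int_closed compact_cball closed_halfspace_le)
  moreover have "y\<^sub>0 \<in> S" using y\<^sub>0 by (auto simp: S_def inner_commute)
  moreover have "continuous_on S ?U"
    using continuous_reflection_gap continuous_on_subset by blast
  ultimately obtain x where x: "x \<in> S" "\<And>y. y \<in> S \<Longrightarrow> ?U x \<le> ?U y"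
    using continuous_attains_inf[of S ?U] by blast
  have Ux: "?U x \<le> ?U y\<^sub>0" using x \<open>y\<^sub>0 \<in> S\<close> by blast
  have "x \<bullet> e \<noteq> l"
    using Ux y\<^sub>0 reflection_gap_on_plane[of x e l u] by auto
  then have "x \<bullet> e < l" using x by (simp add: S_def inner_commute)
  moreover have "?U x \<le> ?U y" if "y \<bullet> e < l" for y
  proof (cases "y \<in> S")
    case False
    then have "norm y \<ge> \<rho>" using that by (simp add: S_def inner_commute)
    then have "?U y\<^sub>0 < ?U y"
      using \<rho>[of y] u_pos[of "reflect e l y"] by (simp add: reflection_gap_def)
    then show ?thesis using Ux by simp
  qed (use x in auto)
  moreover have "?U x < 0" using Ux y\<^sub>0 by linarith
  ultimately show ?thesis by blast
qed

text \<open>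
  At a negative minimum of the gap \<open>U\<close> of \<open>u\<close> the damping term has the favourable sign, since \<open>h\<close> is
  increasing. What remains of the equation forces the gap \<open>V\<close> of \<open>v\<close> to be negative at the same point, and
  bounds \<open>U\<close> there by \<open>V\<close>.
\<close>

lemma negative_minimum_forces_other_gap:
  fixes e x :: 'a and l :: real
  defines "U \<equiv> reflection_gap u e l" and "V \<equiv> reflection_gap v e l" and "\<delta> \<equiv> l - x \<bullet> e"
  assumes e: "norm e = 1" and x: "x \<bullet> e < l"
    and neg: "U x < 0" and min: "\<And>y. y \<bullet> e < l \<Longrightarrow> U x \<le> U y"
  shows "V x < 0"
    and "min_const * \<delta> powr (DIM('a) - N) * (- U x) \<le> a * \<beta> * K * (1 + norm x) powr (- 2 * (N - DIM('a))) * (- V x)"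
proof -
  let ?x' = "reflect e l x"
  have \<delta>: "\<delta> > 0" using x by (simp add: \<delta>_def)
  have "h (u ?x') \<le> h (u x)"
    using neg u_pos by (intro h_mono) (auto simp: U_def reflection_gap_def)
  then have "a * (v ?x' powr \<beta> - v x powr \<beta>) \<le> L ?x' - L x"
    by (simp add: equation right_diff_distrib)
  also have "\<dots> \<le> min_const * \<delta> powr (DIM('a) - N) * U x"
    using gap_operator_at_negative_minimum[OF e x] neg min
    by (simp add: min_const_def U_def \<delta>_def)
  finally have key: "min_const * \<delta> powr (DIM('a) - N) * (- U x) \<le> a * (v x powr \<beta> - v ?x' powr \<beta>)"
    by (simp add: algebra_simps)
  have "0 < min_const * \<delta> powr (DIM('a) - N) * (- U x)"
    using min_const_pos \<delta> neg by (intro mult_pos_pos) auto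
  with key have "v ?x' powr \<beta> < v x powr \<beta>"
    using a_pos by (smt (verit) zero_less_mult_pos)
  then have lt: "v ?x' < v x"
    using powr_mono2[of \<beta> "v x" "v ?x'"] \<beta> v_pos[of x] by (smt (verit))
  then show V: "V x < 0" by (simp add: V_def reflection_gap_def)
  have "v x powr \<beta> - v ?x' powr \<beta> \<le> \<beta> * v x powr (\<beta> - 1) * (v x - v ?x')"
    using lt v_pos \<beta> by (intro powr_diff_le) auto
  also have "\<dots> \<le> \<beta> * (K * (1 + norm x) powr (- 2 * (N - DIM('a)))) * (- V x)"
    using V \<beta> v_decay by (auto simp: V_def reflection_gap_def intro!: mult_right_mono mult_left_mono)
  finally have "a * (v x powr \<beta> - v ?x' powr \<beta>) \<le> a * (\<beta> * (K * (1 + norm x) powr (- 2 * (N - DIM('a)))) * (- V x))"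
    using a_pos by (intro mult_left_mono) auto
  with key show "min_const * \<delta> powr (DIM('a) - N) * (- U x) \<le> a * \<beta> * K * (1 + norm x) powr (- 2 * (N - DIM('a))) * (- V x)"
    by (simp add: mult_ac)
qed

text \<open>
  At a zero of \<open>U\<close> in the half-space the damping terms cancel and \<open>V \<ge> 0\<close> makes the right-hand side
  nonnegative; the strong maximum principle then excludes any point with a nonzero gap.
\<close>

lemma gap_positive_or_zero:
  assumes e: "norm e = 1"
    and U: "\<And>y. y \<bullet> e < l \<Longrightarrow> reflection_gap u e l y \<ge> 0"
    and V: "\<And>y. y \<bullet> e < l \<Longrightarrow> reflection_gap v e l y \<ge> 0"
    and x: "x \<bullet> e < l" "reflection_gap u e l x = 0" and y: "y \<bullet> e < l"
  shows "reflection_gap u e l y = 0"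
proof (rule ccontr)
  assume "reflection_gap u e l y \<noteq> 0"
  then have "L (reflect e l x) < L x"
    using gap_operator_at_zero_minimum[OF e x(1) x(2) U y] by blast
  moreover have "v x powr \<beta> \<le> v (reflect e l x) powr \<beta>"
    using V[OF x(1)] v_pos[of x] \<beta> by (intro powr_mono2) (auto simp: reflection_gap_def)
  ultimately show False
    using x a_pos by (simp add: equation reflection_gap_def)
qed

lemma other_gap_zero:
  assumes e: "norm e = 1"
    and U: "\<And>y. reflection_gap u e l y = 0"
  shows "reflection_gap v e l x = 0"
proof -
  have sym: "u (reflect e l y) = u y" for y using U[of y] by (simp add: reflection_gap_def)
  have "truncated_integral N u (reflect e l x) \<epsilon> = truncated_integral N u x \<epsilon>" if "\<epsilon> > 0" for \<epsilon>
    using truncated_integral_reflect(2)[OF e that, of l x] by (simp add: U)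
  then have "\<forall>\<^sub>F \<epsilon> in at_right 0. truncated_integral N u (reflect e l x) \<epsilon> = truncated_integral N u x \<epsilon>"
    using eventually_at_right_less[of "0::real"] by (rule eventually_mono[rotated]) auto
  then have "(truncated_integral N u x \<longlongrightarrow> L (reflect e l x)) (at_right 0)"
    using limit[of "reflect e l x"] by (simp add: tendsto_cong)
  then have "L (reflect e l x) = L x"
    using limit[of x] by (rule tendsto_unique[rotated]) simp
  then have "v (reflect e l x) powr \<beta> = v x powr \<beta>"
    using a_pos by (simp add: equation sym)
  then have "v (reflect e l x) = v x"
    using powr_less_mono2[of \<beta> "v (reflect e l x)" "v x"] powr_less_mono2[of \<beta> "v x" "v (reflect e l x)"]
      v_pos[of x] v_pos[of "reflect e l x"] \<beta> by (smt (verit))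
  then show ?thesis by (simp add: reflection_gap_def)
qed

end

section \<open>Locating the negative minima of a system\<close>

locale competitive_system =
  u: competitive_equation N u Lu v hu a \<beta> K + v: competitive_equation N v Lv u hv a \<beta> K
  for N :: real and u v Lu Lv :: "'a::euclidean_space \<Rightarrow> real" and hu hv a \<beta> K
begin

lemma K_pos: "K > 0"
proof -
  have "0 < u 0 powr (\<beta> - 1)" using u.u_pos[of 0] by simp
  also have "\<dots> \<le> K" using v.v_decay[of 0] by simp
  finally show ?thesis .
qed

definition loc_const :: real where
  "loc_const = (a * \<beta> * K / u.min_const) powr (2 / (N - DIM('a)))"

lemma loc_const_pos: "loc_const > 0"
  using u.a_pos u.\<beta> K_pos u.min_const_pos by (simp add: loc_const_def)

text \<open>
  Let \<open>x\<close> and \<open>y\<close> be the negative minima of the two gaps, at distances \<open>\<delta>\<close> and \<open>\<eta>\<close> from the plane. Each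
  equation bounds one minimal value by the other one, because \<open>V x \<ge> V y\<close> and \<open>U y \<ge> U x\<close>. In the product of the two
  estimates the values of the gaps cancel. What is left relates \<open>\<delta> * \<eta>\<close> to the decay of the
  coefficients, with a constant that does not depend on the plane.
\<close>

lemma negative_minima_located:
  fixes e :: 'a
  assumes e: "norm e = 1"
    and y\<^sub>0: "y\<^sub>0 \<bullet> e < l" "reflection_gap u e l y\<^sub>0 < 0 \<or> reflection_gap v e l y\<^sub>0 < 0"
  shows "\<exists>x y. x \<bullet> e < l \<and> y \<bullet> e < l \<and> reflection_gap u e l x < 0 \<and> reflection_gap v e l y < 0 \<and>
    ((1 + norm x) * (1 + norm y))\<^sup>2 \<le> loc_const * ((l - x \<bullet> e) * (l - y \<bullet> e))"
proof -
  let ?U = "reflection_gap u e l" and ?V = "reflection_gap v e l"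
  have exU: "\<exists>x. x \<bullet> e < l \<and> ?U x < 0 \<and> (\<forall>y. y \<bullet> e < l \<longrightarrow> ?U x \<le> ?U y)"
    if "y \<bullet> e < l" "?U y < 0" for y by (rule u.negative_minimum_exists[OF e that])
  have exV: "\<exists>x. x \<bullet> e < l \<and> ?V x < 0 \<and> (\<forall>y. y \<bullet> e < l \<longrightarrow> ?V x \<le> ?V y)"
    if "y \<bullet> e < l" "?V y < 0" for y by (rule v.negative_minimum_exists[OF e that])
  have "\<exists>y. y \<bullet> e < l \<and> ?U y < 0" "\<exists>y. y \<bullet> e < l \<and> ?V y < 0"
    using y\<^sub>0 exU exV u.negative_minimum_forces_other_gap(1)[OF e]
      v.negative_minimum_forces_other_gap(1)[OF e] by metis+
  then obtain x y where x: "x \<bullet> e < l" "?U x < 0" "\<And>z. z \<bullet> e < l \<Longrightarrow> ?U x \<le> ?U z"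
    and y: "y \<bullet> e < l" "?V y < 0" "\<And>z. z \<bullet> e < l \<Longrightarrow> ?V y \<le> ?V z"
    using exU exV by metis
  define \<alpha> where "\<alpha> = N - DIM('a)"
  have \<alpha>: "\<alpha> > 0" using u.N by (simp add: \<alpha>_def)
  define B where "B = a * \<beta> * K"
  have B: "B > 0" using u.a_pos u.\<beta> K_pos by (simp add: B_def)
  note c = u.min_const_pos
  define X Y where "X = 1 + norm x" and "Y = 1 + norm y"
  define \<delta> \<eta> where "\<delta> = l - x \<bullet> e" and "\<eta> = l - y \<bullet> e"
  have pos: "X > 0" "Y > 0" "\<delta> > 0" "\<eta> > 0" using x y by (auto simp: X_def Y_def \<delta>_def \<eta>_def add_pos_nonneg)
  have "u.min_const * \<delta> powr (- \<alpha>) * (- ?U x) \<le> B * X powr (- 2 * \<alpha>) * (- ?V x)"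
    using u.negative_minimum_forces_other_gap(2)[OF e x(1,2,3)] by (simp add: X_def \<delta>_def \<alpha>_def B_def)
  also have "\<dots> \<le> B * X powr (- 2 * \<alpha>) * (- ?V y)"
    using y(3)[OF x(1)] B by (intro mult_left_mono) auto
  finally have 1: "u.min_const * \<delta> powr (- \<alpha>) * (- ?U x) \<le> B * X powr (- 2 * \<alpha>) * (- ?V y)" .
  have "u.min_const * \<eta> powr (- \<alpha>) * (- ?V y) \<le> B * Y powr (- 2 * \<alpha>) * (- ?U y)"
    using v.negative_minimum_forces_other_gap(2)[OF e y(1,2,3)] by (simp add: Y_def \<eta>_def \<alpha>_def B_def)
  also have "\<dots> \<le> B * Y powr (- 2 * \<alpha>) * (- ?U x)"
    using x(3)[OF y(1)] B by (intro mult_left_mono) auto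
  finally have 2: "u.min_const * \<eta> powr (- \<alpha>) * (- ?V y) \<le> B * Y powr (- 2 * \<alpha>) * (- ?U x)" .
  define p q where "p = - ?U x" and "q = - ?V y"
  have pq: "p > 0" "q > 0" using x y by (auto simp: p_def q_def)
  have "(u.min_const * \<delta> powr (- \<alpha>) * p) * (u.min_const * \<eta> powr (- \<alpha>) * q)
      \<le> (B * X powr (- 2 * \<alpha>) * q) * (B * Y powr (- 2 * \<alpha>) * p)"
  proof (rule mult_mono)
    show "u.min_const * \<delta> powr (- \<alpha>) * p \<le> B * X powr (- 2 * \<alpha>) * q"
      using 1 by (simp only: p_def q_def)
    show "u.min_const * \<eta> powr (- \<alpha>) * q \<le> B * Y powr (- 2 * \<alpha>) * p"
      using 2 by (simp only: p_def q_def)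
  qed (use pq B c in auto)
  then have "(u.min_const\<^sup>2 * (\<delta> * \<eta>) powr (- \<alpha>)) * (p * q) \<le> (B\<^sup>2 * (X * Y) powr (- 2 * \<alpha>)) * (p * q)"
    using pos by (simp add: powr_mult power2_eq_square mult_ac)
  then have "u.min_const\<^sup>2 * (\<delta> * \<eta>) powr (- \<alpha>) \<le> B\<^sup>2 * (X * Y) powr (- 2 * \<alpha>)"
    using pq by (simp add: mult_le_cancel_right)
  then have "(X * Y) powr (2 * \<alpha>) \<le> (B / u.min_const)\<^sup>2 * (\<delta> * \<eta>) powr \<alpha>"
    using pos c by (simp add: powr_minus field_simps)
  then have "((X * Y) powr (2 * \<alpha>)) powr (1 / \<alpha>) \<le> ((B / u.min_const)\<^sup>2 * (\<delta> * \<eta>) powr \<alpha>) powr (1 / \<alpha>)"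
    using \<alpha> by (intro powr_mono2) auto
  also have "((X * Y) powr (2 * \<alpha>)) powr (1 / \<alpha>) = (X * Y)\<^sup>2"
    using \<alpha> pos by (simp add: powr_powr powr_numeral)
  also have "((B / u.min_const)\<^sup>2 * (\<delta> * \<eta>) powr \<alpha>) powr (1 / \<alpha>) = loc_const * (\<delta> * \<eta>)"
  proof -
    have "((B / u.min_const)\<^sup>2) powr (1 / \<alpha>) = loc_const"
      using B c \<alpha> by (simp add: loc_const_def B_def[symmetric] \<alpha>_def[symmetric] powr_powr flip: powr_numeral)
    then show ?thesis using \<alpha> pos by (simp add: powr_mult powr_powr)
  qed
  finally show ?thesis
    using x y by (intro exI[of _ x] exI[of _ y]) (simp add: X_def Y_def \<delta>_def \<eta>_def)
qed

end

section \<open>Moving the plane\<close>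

context competitive_system
begin

text \<open>
  When the plane has a negative offset \<open>l\<close>, points of the half-space satisfy \<open>\<delta> \<le> norm x\<close>. The location
  estimate then bounds \<open>(1 + norm x) * (1 + norm y)\<close> by a constant, which contradicts \<open>norm x > - l\<close>.
\<close>

lemma gaps_nonneg_far_left:
  assumes e: "norm e = 1" and l: "l \<le> - loc_const" and y: "y \<bullet> e < l"
  shows "reflection_gap u e l y \<ge> 0 \<and> reflection_gap v e l y \<ge> 0"
proof (rule ccontr)
  assume "\<not> ?thesis"
  then obtain x y where x: "x \<bullet> e < l" and y: "y \<bullet> e < l"
    and le: "((1 + norm x) * (1 + norm y))\<^sup>2 \<le> loc_const * ((l - x \<bullet> e) * (l - y \<bullet> e))"
    using negative_minima_located[OF e y] by (auto simp: not_le)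
  have abs: "\<bar>z \<bullet> e\<bar> \<le> norm z" for z using Cauchy_Schwarz_ineq2[of z e] e by simp
  have "l - x \<bullet> e \<le> 1 + norm x" "l - y \<bullet> e \<le> 1 + norm y"
    using abs[of x] abs[of y] l loc_const_pos by linarith+
  then have "loc_const * ((l - x \<bullet> e) * (l - y \<bullet> e)) \<le> loc_const * ((1 + norm x) * (1 + norm y))"
    using x y loc_const_pos by (intro mult_left_mono mult_mono) auto
  with le have "((1 + norm x) * (1 + norm y)) * ((1 + norm x) * (1 + norm y)) \<le> loc_const * ((1 + norm x) * (1 + norm y))"
    by (simp add: power2_eq_square)
  then have "(1 + norm x) * (1 + norm y) \<le> loc_const"
    by (rule mult_right_le_imp_le) (auto intro!: mult_pos_pos add_pos_nonneg)
  moreover have "(1 + norm x) * 1 \<le> (1 + norm x) * (1 + norm y)"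
    by (intro mult_left_mono) auto
  ultimately show False using abs[of x] x l by simp
qed

text \<open>
  For planes with bounded offset, the location estimate keeps the minima bounded and away from the
  plane. This one compactness statement replaces both a narrow region principle and a separate
  analysis at infinity.
\<close>

lemma negative_minimum_in_fixed_compact_set:
  assumes e: "norm e = 1"
  shows "\<exists>B d. d > 0 \<and> (\<forall>l y. \<bar>l\<bar> \<le> M \<longrightarrow> y \<bullet> e < l \<longrightarrow>
    reflection_gap u e l y < 0 \<or> reflection_gap v e l y < 0 \<longrightarrow>
    (\<exists>x. norm x \<le> B \<and> x \<bullet> e \<le> l - d \<and> reflection_gap u e l x < 0))"
proof (cases "M \<ge> 0")
  case False
  then show ?thesis by (intro exI[of _ 1]) auto
next
  case True
  define B where "B = loc_const * (M + 1)\<^sup>2"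
  have B: "B > 0" using True loc_const_pos by (simp add: B_def)
  show ?thesis
  proof (rule exI[of _ B], rule exI[of _ "1 / (loc_const * (M + B))"], intro conjI allI impI)
    show d: "1 / (loc_const * (M + B)) > 0" using True loc_const_pos B by simp
    fix l y\<^sub>0
    assume l: "\<bar>l\<bar> \<le> M" and y\<^sub>0: "y\<^sub>0 \<bullet> e < l" "reflection_gap u e l y\<^sub>0 < 0 \<or> reflection_gap v e l y\<^sub>0 < 0"
    obtain x y where x: "x \<bullet> e < l" "reflection_gap u e l x < 0" and y: "y \<bullet> e < l"
      and le: "((1 + norm x) * (1 + norm y))\<^sup>2 \<le> loc_const * ((l - x \<bullet> e) * (l - y \<bullet> e))"
      using negative_minima_located[OF e y\<^sub>0] by blast
    have abs: "\<bar>z \<bullet> e\<bar> \<le> norm z" for z using Cauchy_Schwarz_ineq2[of z e] e by simp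
    have lin: "l - z \<bullet> e \<le> M + norm z" for z using abs[of z] l by linarith
    have lin': "l - z \<bullet> e \<le> (M + 1) * (1 + norm z)" for z
      using lin[of z] mult_nonneg_nonneg[OF True norm_ge_zero[of z]] by (simp add: algebra_simps)
    define P where "P = (1 + norm x) * (1 + norm y)"
    have "1 * (1 + norm x) \<le> (1 + norm y) * (1 + norm x)" "1 * (1 + norm y) \<le> (1 + norm x) * (1 + norm y)"
      by (intro mult_right_mono; simp)+
    then have P: "1 + norm x \<le> P" "1 + norm y \<le> P" by (simp_all add: P_def mult.commute)
    then have P1: "P \<ge> 1" by (smt (verit) norm_ge_zero)
    have "loc_const * ((l - x \<bullet> e) * (l - y \<bullet> e)) \<le> loc_const * (((M + 1) * (1 + norm x)) * ((M + 1) * (1 + norm y)))"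
      using x y loc_const_pos lin' True by (intro mult_left_mono mult_mono) auto
    with le have "P * P \<le> B * P" by (simp add: P_def B_def power2_eq_square mult_ac)
    then have PB: "P \<le> B" by (rule mult_right_le_imp_le) (use P1 in auto)
    have "1 \<le> P\<^sup>2" using P1 by simp
    also have "\<dots> \<le> loc_const * ((l - x \<bullet> e) * (l - y \<bullet> e))" using le by (simp add: P_def)
    also have "\<dots> \<le> loc_const * ((l - x \<bullet> e) * (M + B))"
      using lin[of y] P PB x loc_const_pos by (intro mult_left_mono) auto
    finally have "1 / (loc_const * (M + B)) \<le> l - x \<bullet> e"
      using True loc_const_pos B by (subst pos_divide_le_eq) (auto simp: mult_ac)
    then show "\<exists>x. norm x \<le> B \<and> x \<bullet> e \<le> l - 1 / (loc_const * (M + B)) \<and> reflection_gap u e l x < 0"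
      using P PB x by (intro exI[of _ x]) auto
  qed
qed

lemma gap_tendsto:
  assumes "(m \<longlongrightarrow> l) F" "(y \<longlongrightarrow> x) F" and f: "continuous_on UNIV f"
  shows "((\<lambda>t. reflection_gap f e (m t) (y t)) \<longlongrightarrow> reflection_gap f e l x) F"
proof -
  have f': "isCont f z" for z using f by (simp add: continuous_on_eq_continuous_at)
  show ?thesis
    unfolding reflection_gap_def reflect_def
    by (intro tendsto_intros isCont_tendsto_compose[OF f'] assms)
qed

text \<open>
  Let \<open>l\<^sub>0\<close> be the supremum of the offsets up to which both gaps are nonnegative. It is finite because
  \<open>u\<close> is positive at the origin and small far away. If the gap of \<open>u\<close> were positive on the whole half-space at \<open>l\<^sub>0\<close>,
  then negative minima for offsets decreasing to \<open>l\<^sub>0\<close> would accumulate at a point strictly inside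
  that half-space, where the gap would be nonpositive. So it has a zero, hence vanishes
  identically, and with it the gap of \<open>v\<close>.
\<close>

theorem symmetry_plane_exists:
  assumes e: "norm e = 1"
  shows "\<exists>l. \<forall>x. u (reflect e l x) = u x \<and> v (reflect e l x) = v x"
proof -
  define good where "good = (\<lambda>l. \<forall>y. y \<bullet> e < l \<longrightarrow> reflection_gap u e l y \<ge> 0 \<and> reflection_gap v e l y \<ge> 0)"
  define S where "S = {l. \<forall>m\<le>l. good m}"
  have "- loc_const \<in> S"
    using gaps_nonneg_far_left[OF e] by (auto simp: S_def good_def)
  obtain \<rho> where \<rho>: "\<And>y. norm y \<ge> \<rho> \<Longrightarrow> u y < u 0"
    using u.small_far_away[of "u 0"] u.u_pos[of 0] by auto
  have bdd: "l \<le> max \<rho> 0" if "l \<in> S" for l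
  proof (rule ccontr)
    assume "\<not> l \<le> max \<rho> 0"
    then have l: "l > \<rho>" "l > 0" by auto
    have "u (reflect e l 0) < u 0"
      using l e by (intro \<rho>) (auto simp: reflect_def)
    moreover have "reflection_gap u e l 0 \<ge> 0"
      using that l by (auto simp: S_def good_def)
    ultimately show False by (simp add: reflection_gap_def)
  qed
  define l\<^sub>0 where "l\<^sub>0 = Sup S"
  have S_bdd: "bdd_above S" using bdd by (auto simp: bdd_above_def)
  have below: "good l" if l: "l < l\<^sub>0" for l
  proof -
    obtain s where "s \<in> S" "l < s"
      using less_cSupE[of l S] l \<open>- loc_const \<in> S\<close> unfolding l\<^sub>0_def by auto
    then show ?thesis by (auto simp: S_def)
  qed
  have at: "good l\<^sub>0"
    unfolding good_def
  proof (intro allI impI)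
    fix y assume y: "y \<bullet> e < l\<^sub>0"
    have ev: "\<forall>\<^sub>F l in at_left l\<^sub>0. l \<in> {y \<bullet> e<..<l\<^sub>0}"
      by (rule eventually_at_left_real[OF y])
    have "0 \<le> reflection_gap u e l\<^sub>0 y"
    proof (rule tendsto_lowerbound)
      show "((\<lambda>l. reflection_gap u e l y) \<longlongrightarrow> reflection_gap u e l\<^sub>0 y) (at_left l\<^sub>0)"
        by (intro gap_tendsto u.continuous tendsto_intros)
      show "\<forall>\<^sub>F l in at_left l\<^sub>0. 0 \<le> reflection_gap u e l y"
        using ev by eventually_elim (use below in \<open>auto simp: good_def\<close>)
    qed simp
    moreover have "0 \<le> reflection_gap v e l\<^sub>0 y"
    proof (rule tendsto_lowerbound)
      show "((\<lambda>l. reflection_gap v e l y) \<longlongrightarrow> reflection_gap v e l\<^sub>0 y) (at_left l\<^sub>0)"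
        by (intro gap_tendsto v.continuous tendsto_intros)
      show "\<forall>\<^sub>F l in at_left l\<^sub>0. 0 \<le> reflection_gap v e l y"
        using ev by eventually_elim (use below in \<open>auto simp: good_def\<close>)
    qed simp
    ultimately show "0 \<le> reflection_gap u e l\<^sub>0 y \<and> 0 \<le> reflection_gap v e l\<^sub>0 y" ..
  qed
  have "\<exists>x. x \<bullet> e < l\<^sub>0 \<and> reflection_gap u e l\<^sub>0 x = 0"
  proof (rule ccontr)
    assume "\<not> ?thesis"
    then have pos: "reflection_gap u e l\<^sub>0 x > 0" if "x \<bullet> e < l\<^sub>0" for x
      using at that by (force simp: good_def)
    obtain B d where d: "d > 0" and Bd: "\<And>l y. \<bar>l\<bar> \<le> \<bar>l\<^sub>0\<bar> + 1 \<Longrightarrow> y \<bullet> e < l \<Longrightarrow>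
        reflection_gap u e l y < 0 \<or> reflection_gap v e l y < 0 \<Longrightarrow>
        \<exists>x. norm x \<le> B \<and> x \<bullet> e \<le> l - d \<and> reflection_gap u e l x < 0"
      using negative_minimum_in_fixed_compact_set[OF e, of "\<bar>l\<^sub>0\<bar> + 1"] by blast
    have "\<exists>l x. l\<^sub>0 < l \<and> l \<le> l\<^sub>0 + inverse (real (Suc k)) \<and> norm x \<le> B \<and> x \<bullet> e \<le> l - d \<and> reflection_gap u e l x < 0" for k
    proof -
      have i: "0 < inverse (real (Suc k))" "inverse (real (Suc k)) \<le> 1" by (auto simp: field_simps)
      have "l\<^sub>0 + inverse (real (Suc k)) \<notin> S"
        using cSup_upper[OF _ S_bdd] i unfolding l\<^sub>0_def by fastforce
      then obtain l where l: "l \<le> l\<^sub>0 + inverse (real (Suc k))" "\<not> good l" by (auto simp: S_def)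
      then have "l\<^sub>0 < l" using below[of l] at by (cases "l < l\<^sub>0"; cases "l = l\<^sub>0") auto
      moreover have "\<bar>l\<bar> \<le> \<bar>l\<^sub>0\<bar> + 1" using l i \<open>l\<^sub>0 < l\<close> by linarith
      moreover obtain y where "y \<bullet> e < l" "reflection_gap u e l y < 0 \<or> reflection_gap v e l y < 0"
        using l by (auto simp: good_def not_le)
      ultimately show ?thesis using Bd l by blast
    qed
    then obtain m X where m: "\<And>k. l\<^sub>0 < m k" "\<And>k. m k \<le> l\<^sub>0 + inverse (real (Suc k))"
      and X: "\<And>k. norm (X k) \<le> B" "\<And>k. X k \<bullet> e \<le> m k - d" "\<And>k. reflection_gap u e (m k) (X k) < 0"
      by metis
    have "m \<longlonglongrightarrow> l\<^sub>0"
    proof (rule tendsto_sandwich[of "\<lambda>_. l\<^sub>0" m _ "\<lambda>k. l\<^sub>0 + inverse (real (Suc k))"])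
      show "(\<lambda>k. l\<^sub>0 + inverse (real (Suc k))) \<longlonglongrightarrow> l\<^sub>0"
        using tendsto_add[OF tendsto_const[of l\<^sub>0] LIMSEQ_inverse_real_of_nat] by simp
      show "\<forall>\<^sub>F k in sequentially. l\<^sub>0 \<le> m k"
        using m(1) by (simp add: less_imp_le)
      show "\<forall>\<^sub>F k in sequentially. m k \<le> l\<^sub>0 + inverse (real (Suc k))"
        using m(2) by (intro always_eventually allI)
    qed simp
    have "compact (cball (0::'a) B)" by simp
    then obtain x r where r: "strict_mono r" "(X \<circ> r) \<longlonglongrightarrow> x"
      unfolding compact_def using X(1) by (metis mem_cball_0)
    have mr: "(\<lambda>k. m (r k)) \<longlonglongrightarrow> l\<^sub>0"
      using LIMSEQ_subseq_LIMSEQ[OF \<open>m \<longlonglongrightarrow> l\<^sub>0\<close> r(1)] by (simp add: o_def)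
    have Xr: "(\<lambda>k. X (r k)) \<longlonglongrightarrow> x" using r by (simp add: o_def)
    have "x \<bullet> e \<le> l\<^sub>0 - d"
      by (rule LIMSEQ_le[OF tendsto_inner[OF Xr tendsto_const] tendsto_diff[OF mr tendsto_const]])
        (use X in auto)
    moreover have "reflection_gap u e l\<^sub>0 x \<le> 0"
      by (rule LIMSEQ_le[OF gap_tendsto[OF mr Xr u.continuous] tendsto_const])
        (use X(3) in \<open>simp add: less_imp_le\<close>)
    ultimately show False using pos[of x] d by linarith
  qed
  then obtain x where x: "x \<bullet> e < l\<^sub>0" "reflection_gap u e l\<^sub>0 x = 0" by blast
  have half: "reflection_gap u e l\<^sub>0 y = 0" if "y \<bullet> e < l\<^sub>0" for y
    using u.gap_positive_or_zero[OF e _ _ x that] at by (simp add: good_def)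
  have U: "reflection_gap u e l\<^sub>0 y = 0" for y
  proof (rule linorder_cases[of "y \<bullet> e" l\<^sub>0])
    assume "l\<^sub>0 < y \<bullet> e"
    then have "reflection_gap u e l\<^sub>0 (reflect e l\<^sub>0 y) = 0"
      by (intro half) (simp add: reflect_inner[OF e])
    then show ?thesis by (simp add: reflection_gap_reflect[OF e])
  qed (auto simp: half reflection_gap_on_plane)
  then have "reflection_gap v e l\<^sub>0 y = 0" for y by (rule u.other_gap_zero[OF e])
  with U show ?thesis by (auto simp: reflection_gap_def)
qed

end

section \<open>From symmetry planes to a centre\<close>

text \<open>
  The superlevel set \<open>D\<close> is bounded, open and nonempty, and it is invariant under every symmetry of \<open>u\<close>. Its
  barycentre therefore lies on all symmetry planes. Two points equidistant from the barycentre are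
  mirror images in the plane through it that is orthogonal to their difference.
\<close>

lemma radially_symmetric_of_symmetry_planes:
  fixes u v :: "'a::euclidean_space \<Rightarrow> real"
  assumes cont: "continuous_on UNIV u" and pos: "u 0 > 0" and van: "(u \<longlongrightarrow> 0) at_infinity"
    and sym: "\<And>e. norm e = 1 \<Longrightarrow> \<exists>l. \<forall>x. u (reflect e l x) = u x \<and> v (reflect e l x) = v x"
  shows "\<exists>x\<^sub>0. \<forall>x y. norm (x - x\<^sub>0) = norm (y - x\<^sub>0) \<longrightarrow> u x = u y \<and> v x = v y"
proof -
  define D where "D = {x. u 0 / 2 < u x}"
  have D_open: "open D" unfolding D_def using cont by (intro open_Collect_less) auto
  then have [measurable]: "D \<in> sets borel" by simp
  obtain \<rho> where \<rho>: "\<And>y. norm y \<ge> \<rho> \<Longrightarrow> u y < u 0 / 2"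
    using order_tendstoD(2)[OF van, of "u 0 / 2"] pos by (auto simp: eventually_at_infinity)
  have D_sub: "D \<subseteq> cball 0 \<rho>"
  proof
    fix x assume "x \<in> D"
    then show "x \<in> cball 0 \<rho>" using \<rho>[of x] by (cases "\<rho> \<le> norm x") (auto simp: D_def)
  qed
  then have fin: "emeasure lborel D < \<infinity>"
    by (meson bounded_cball bounded_subset emeasure_bounded_finite)
  have W: "measure lborel D > 0"
  proof -
    obtain r where r: "r > 0" "ball 0 r \<subseteq> D"
      using D_open pos openE[of D 0] by (auto simp: D_def)
    have "0 < measure lborel (ball (0::'a) r)" using r by simp
    also have "\<dots> \<le> measure lborel D"
      using r fin by (intro measure_mono_fmeasurable) (auto simp: fmeasurable_def)
    finally show ?thesis .
  qed
  have int: "integrable lborel (\<lambda>x. indicator D x *\<^sub>R x)"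
    using fin D_sub by (intro integrableI_bounded_set_indicator[where B=\<rho>] AE_I2) auto
  define x\<^sub>0 where "x\<^sub>0 = (1 / measure lborel D) *\<^sub>R (LINT x|lborel. indicator D x *\<^sub>R x)"
  have center: "x\<^sub>0 \<bullet> e = l" if e: "norm e = 1" and l: "\<And>x. u (reflect e l x) = u x" for e l
  proof -
    note R = reflect_involutive[OF e] dist_reflect[OF e]
    have i1: "integrable lborel (\<lambda>x. indicator D x * (x \<bullet> e))"
      using integrable_inner_left[OF int, of e] by (simp add: inner_scaleR_left)
    have i2: "integrable lborel (indicator D :: 'a \<Rightarrow> real)"
      using fin by (intro integrable_real_indicator) auto
    define J where "J = (LINT x|lborel. indicator D x * (x \<bullet> e))"
    have "J = (LINT x|lborel. indicator D (reflect e l x) * (reflect e l x \<bullet> e))"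
      unfolding J_def
      using integral_isometric_involution(2)[of "reflect e l" "\<lambda>x. indicator D x * (x \<bullet> e)", OF R] by simp
    also have "\<dots> = (LINT x|lborel. 2 * l * indicator D x - indicator D x * (x \<bullet> e))"
      by (intro Bochner_Integration.integral_cong)
        (auto simp: D_def l reflect_inner[OF e] algebra_simps split: split_indicator)
    also have "\<dots> = 2 * l * measure lborel D - J"
      using i1 i2 by (simp add: J_def)
    finally have "J = l * measure lborel D" by simp
    moreover have "J = (LINT x|lborel. indicator D x *\<^sub>R x) \<bullet> e"
      unfolding J_def using int by (subst integral_inner_left[symmetric]) auto
    ultimately show ?thesis using W by (simp add: x\<^sub>0_def)
  qed
  have "u x = u y \<and> v x = v y" if eq: "norm (x - x\<^sub>0) = norm (y - x\<^sub>0)" for x y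
  proof (cases "x = y")
    case False
    define t where "t = norm (x - y)"
    define e where "e = (1 / t) *\<^sub>R (x - y)"
    have t: "t > 0" using False by (simp add: t_def)
    have e: "norm e = 1" using t by (simp add: e_def t_def)
    have xy: "y = x - t *\<^sub>R e" using t by (simp add: e_def)
    obtain l where l: "\<And>x. u (reflect e l x) = u x" "\<And>x. v (reflect e l x) = v x"
      using sym[OF e] by blast
    have l_eq: "l = x\<^sub>0 \<bullet> e" using center[OF e l(1)] by simp
    define a where "a = x - x\<^sub>0"
    have "(norm a)\<^sup>2 = (norm (a - t *\<^sub>R e))\<^sup>2"
      using eq xy by (simp add: a_def algebra_simps)
    also have "\<dots> = (norm a)\<^sup>2 - 2 * t * (a \<bullet> e) + t\<^sup>2 * (e \<bullet> e)"
      unfolding power2_norm_eq_inner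
      by (simp add: inner_diff_left inner_diff_right inner_commute power2_eq_square)
    finally have "t * (2 * (a \<bullet> e)) = t * t"
      using e by (auto simp: dot_square_norm power2_eq_square)
    then have "2 * (a \<bullet> e) = t" using t by simp
    then have "reflect e l x = y"
      by (simp add: reflect_def l_eq xy a_def inner_diff_left)
    then show ?thesis using l[of x] by metis
  qed simp
  then show ?thesis by blast
qed

section \<open>The fractional system\<close>

lemma decays_like_tendsto_0:
  fixes u :: "real ^ 'n \<Rightarrow> real"
  assumes "decays_like u b" "b > 0" "\<And>x. u x > 0"
  shows "(u \<longlongrightarrow> 0) at_infinity"
proof -
  obtain R where R: "\<And>x. norm x > R \<Longrightarrow> u x \<le> norm x powr (- b)"
    using assms by (auto simp: decays_like_def)
  show ?thesis
  proof (rule tendsto_sandwich[of "\<lambda>_. 0" u])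
    show "((\<lambda>x::real ^ 'n. norm x powr (- b)) \<longlongrightarrow> 0) at_infinity"
      using assms(2) by (intro tendsto_neg_powr filterlim_norm_at_top) auto
    show "\<forall>\<^sub>F x in at_infinity. u x \<le> norm x powr (- b)"
      unfolding eventually_at_infinity using R by (intro exI[of _ "R + 1"]) auto
  qed (use assms(3) in \<open>auto intro!: always_eventually less_imp_le\<close>)
qed

lemma decays_like_global:
  fixes u :: "real ^ 'n \<Rightarrow> real"
  assumes d: "decays_like u b" and b: "b > 0" and cont: "continuous_on UNIV u"
  shows "\<exists>M. \<forall>x. u x \<le> M * (1 + norm x) powr (- b)"
proof -
  obtain R where R: "R > 0" "\<And>x. norm x > R \<Longrightarrow> u x \<le> norm x powr (- b)"
    using d by (auto simp: decays_like_def)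
  define R' where "R' = max R 1"
  have "bounded (u ` cball 0 R')"
    using cont by (intro compact_imp_bounded compact_continuous_image) (auto intro: continuous_on_subset)
  then obtain m where m: "m > 0" "\<forall>y\<in>u ` cball 0 R'. norm y \<le> m"
    unfolding bounded_pos by blast
  then have m_le: "u x \<le> m" if "norm x \<le> R'" for x
    using that by (auto simp: abs_le_iff)
  define M where "M = max (2 powr b) (m * (1 + R') powr b)"
  have "u x \<le> M * (1 + norm x) powr (- b)" for x
  proof (cases "norm x \<le> R'")
    case True
    have "m * (1 + norm x) powr b \<le> m * (1 + R') powr b"
      using True m b by (intro mult_left_mono powr_mono2) auto
    also have "\<dots> \<le> M" by (simp add: M_def)
    finally have "m * (1 + norm x) powr b \<le> M" .
    moreover have "(1 + norm x) powr b > 0" 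
    proof -
      have "1 + norm x \<noteq> 0" using norm_ge_zero[of x] by linarith
      then show ?thesis by simp
    qed
    ultimately have "m \<le> M / (1 + norm x) powr b" by (simp add: pos_le_divide_eq)
    then show ?thesis using m_le[OF True] by (simp add: powr_minus_divide)
  next
    case False
    then have x: "norm x > R" "norm x > 1" by (auto simp: R'_def)
    have "u x \<le> norm x powr (- b)" using R x by auto
    also have "\<dots> \<le> ((1 + norm x) / 2) powr (- b)"
      using x b by (intro powr_mono2') auto
    also have "\<dots> = 2 powr b * (1 + norm x) powr (- b)"
      using x by (simp add: powr_divide powr_minus field_simps)
    also have "\<dots> \<le> M * (1 + norm x) powr (- b)"
      by (intro mult_right_mono) (auto simp: M_def)
    finally show ?thesis .
  qed
  then show ?thesis by blast
qed

text \<open>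
  All sufficiently large constants are admissible, so that the two equations of the system can share
  one.
\<close>

lemma competitive_equation_of_frac_laplacian:
  fixes u v :: "real ^ 'n \<Rightarrow> real"
  defines "n \<equiv> real CARD('n)"
  assumes C: "C > 0" and \<alpha>: "0 < \<alpha>" "\<alpha> < 2" "n > \<alpha>" and p: "p > 1" "\<kappa> > 0"
    and u: "u \<in> L_space \<alpha> \<inter> C11_loc" and v: "continuous_on UNIV v"
    and pos: "\<And>x. u x > 0" "\<And>x. v x > 0"
    and eq: "\<And>x. frac_laplacian C \<alpha> u x = v x powr ((n + \<alpha>) / (n - \<alpha>)) - \<kappa> * u x powr p"
    and decay: "decays_like u (n - \<alpha>)" "decays_like v (n - \<alpha>)"
  shows "\<exists>K\<^sub>0. \<forall>K\<ge>K\<^sub>0. competitive_equation (n + \<alpha>) u (\<lambda>x. frac_laplacian C \<alpha> u x / C) v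
    (\<lambda>t. \<kappa> * t powr p / C) (1 / C) ((n + \<alpha>) / (n - \<alpha>)) K"
proof -
  let ?\<beta> = "(n + \<alpha>) / (n - \<alpha>)"
  have \<beta>: "?\<beta> > 1" "?\<beta> - 1 = 2 * \<alpha> / (n - \<alpha>)" using \<alpha> by (auto simp: field_simps)
  obtain M where M: "\<And>x. v x \<le> M * (1 + norm x) powr (- (n - \<alpha>))"
    using decays_like_global[OF decay(2) _ v] \<alpha> by auto
  have M0: "M > 0" using M[of 0] pos(2)[of 0] by simp
  have v_decay: "v x powr (?\<beta> - 1) \<le> M powr (?\<beta> - 1) * (1 + norm x) powr (- 2 * \<alpha>)" for x
  proof -
    have "v x powr (?\<beta> - 1) \<le> (M * (1 + norm x) powr (- (n - \<alpha>))) powr (?\<beta> - 1)"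
      using M pos(2)[of x] \<beta> by (intro powr_mono2) auto
    also have "\<dots> = M powr (?\<beta> - 1) * (1 + norm x) powr (- (n - \<alpha>) * (?\<beta> - 1))"
      using M0 by (simp add: powr_mult powr_powr)
    also have "- (n - \<alpha>) * (?\<beta> - 1) = - 2 * \<alpha>"
    proof -
      have "(n - \<alpha>) * (2 * \<alpha> / (n - \<alpha>)) = 2 * \<alpha>" using \<alpha> by simp
      then show ?thesis unfolding \<beta>(2) by (simp only: mult_minus_left)
    qed
    finally show ?thesis .
  qed
  have c: "continuous_on UNIV u" using u C11_loc_continuous by blast
  show ?thesis
  proof (intro exI[of _ "M powr (?\<beta> - 1)"] allI impI, unfold_locales)
    fix K assume K: "M powr (?\<beta> - 1) \<le> K"
    show "real DIM(real ^ 'n) < n + \<alpha>" using \<alpha> by (simp add: n_def)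
    show "integrable lborel (\<lambda>y. \<bar>u y\<bar> / (1 + norm y powr (n + \<alpha>)))"
      using L_space_integrable_lborel[OF u] by (simp add: n_def)
    show "(truncated_integral (n + \<alpha>) u x \<longlongrightarrow> frac_laplacian C \<alpha> u x / C) (at_right 0)" for x
      unfolding n_def by (rule truncated_integral_tendsto_frac_laplacian[OF C \<alpha>(1,2) u])
    show "frac_laplacian C \<alpha> u x / C = 1 / C * v x powr ?\<beta> - \<kappa> * u x powr p / C" for x
      by (simp add: eq diff_divide_distrib)
    show "\<kappa> * s powr p / C \<le> \<kappa> * t powr p / C" if "0 < s" "s \<le> t" for s t
      using that p C by (intro divide_right_mono mult_left_mono powr_mono2) auto
    show "(u \<longlongrightarrow> 0) at_infinity"
      using decays_like_tendsto_0[OF decay(1) _ pos(1)] \<alpha> by simp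
    have "M powr (?\<beta> - 1) * (1 + norm x) powr (- 2 * \<alpha>) \<le> K * (1 + norm x) powr (- 2 * \<alpha>)" for x :: "real ^ 'n"
      using K by (intro mult_right_mono) auto
    with v_decay show "v x powr (?\<beta> - 1) \<le> K * (1 + norm x) powr (- 2 * (n + \<alpha> - real DIM(real ^ 'n)))" for x
      by (force simp: n_def intro: order.trans)
  qed (use c pos C \<beta> in auto)
qed

theorem corollary6:
  fixes u v :: "real ^ 'n \<Rightarrow> real"
    and C \<alpha> p s \<kappa>\<^sub>1 \<kappa>\<^sub>2 :: real
  assumes "C > 0"
    and "0 < \<alpha>" and "\<alpha> < 2" and "real CARD('n) > \<alpha>"
    and "p > 1" and "s > 1" and "\<kappa>\<^sub>1 > 0" and "\<kappa>\<^sub>2 > 0"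
    and "u \<in> L_space \<alpha> \<inter> C11_loc" and "v \<in> L_space \<alpha> \<inter> C11_loc"
    and "\<And>x. u x > 0" and "\<And>x. v x > 0"
    and "\<And>x. frac_laplacian C \<alpha> u x =
           v x powr ((real CARD('n) + \<alpha>) / (real CARD('n) - \<alpha>)) - \<kappa>\<^sub>1 * u x powr p"
    and "\<And>x. frac_laplacian C \<alpha> v x =
           u x powr ((real CARD('n) + \<alpha>) / (real CARD('n) - \<alpha>)) - \<kappa>\<^sub>2 * v x powr s"
    and "decays_like u (real CARD('n) - \<alpha>)" and "decays_like v (real CARD('n) - \<alpha>)"
  shows "\<exists>x0. radially_symmetric_about x0 u \<and> radially_symmetric_about x0 v"
proof -
  let ?n = "real CARD('n)"
  let ?\<beta> = "(?n + \<alpha>) / (?n - \<alpha>)"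
  have cont: "continuous_on UNIV u" "continuous_on UNIV v"
    using assms(9,10) C11_loc_continuous by blast+
  obtain K\<^sub>1 where K\<^sub>1: "\<And>K. K \<ge> K\<^sub>1 \<Longrightarrow> competitive_equation (?n + \<alpha>) u (\<lambda>x. frac_laplacian C \<alpha> u x / C) v
    (\<lambda>t. \<kappa>\<^sub>1 * t powr p / C) (1 / C) ?\<beta> K"
    using competitive_equation_of_frac_laplacian[OF assms(1-5,7,9) cont(2) assms(11,12,13,15,16)] by blast
  obtain K\<^sub>2 where K\<^sub>2: "\<And>K. K \<ge> K\<^sub>2 \<Longrightarrow> competitive_equation (?n + \<alpha>) v (\<lambda>x. frac_laplacian C \<alpha> v x / C) u
    (\<lambda>t. \<kappa>\<^sub>2 * t powr s / C) (1 / C) ?\<beta> K"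
    using competitive_equation_of_frac_laplacian[OF assms(1-4,6,8,10) cont(1) assms(12,11,14,16,15)] by blast
  interpret competitive_system "?n + \<alpha>" u v "\<lambda>x. frac_laplacian C \<alpha> u x / C" "\<lambda>x. frac_laplacian C \<alpha> v x / C"
    "\<lambda>t. \<kappa>\<^sub>1 * t powr p / C" "\<lambda>t. \<kappa>\<^sub>2 * t powr s / C" "1 / C" ?\<beta> "max K\<^sub>1 K\<^sub>2"
    by (intro competitive_system.intro K\<^sub>1 K\<^sub>2) auto
  have "\<exists>x\<^sub>0. \<forall>x y. norm (x - x\<^sub>0) = norm (y - x\<^sub>0) \<longrightarrow> u x = u y \<and> v x = v y"
    by (rule radially_symmetric_of_symmetry_planes[OF cont(1) assms(11) u.u_vanishes symmetry_plane_exists])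
  then show ?thesis
    unfolding radially_symmetric_about_def by blast
qed

end
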